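(* Let $\eta_1=0.1866823\ldots$ and $\eta_2=2.1555352\ldots$ be the two real solutions of $\eta(1-\log \eta)=1/2$, and fix constants $\delta_1,\delta_2$ with $0<\delta_1<\eta_1<\eta_2<\delta_2$. Then $$B_{n,\mathcal{S}}= \frac{n!\, \exp\bigl(e^r-1-\alpha_{\mathcal{S}}(r)\bigr)}{ r^n \sqrt{2\pi r(r+1)e^r}} \left(1+O\left(\frac{1+(\alpha_{\mathcal{S}}'(r))^2}{e^r}\right)\right),$$ uniformly for all sets $\mathcal{S}\subset\mathbb{N}$ with $\mathcal{S}\cap[\delta_1 r,\delta_2 r]=\emptyset$; that is, the constant implied by the $O$-symbol depends only on $\delta_1,\delta_2$ and not on $n$ or $\mathcal{S}$.
   Context: For $\mathcal{S}\subset\mathbb{N}=\{1,2,\ldots\}$ and $n\ge 1$, $B_{n,\mathcal{S}}$ denotes the number of partitions of a set with $n$ elements (into nonempty blocks) none of whose block sizes lie in $\mathcal{S}$; $B_{0,\mathcal{S}}=1$. For $n\ge1$, $r=r(n)$ denotes the real solution of $re^r=n$. Also $\alpha_{\mathcal{S}}(z)=\sum_{k\in\mathcal{S}} z^k/k!$, and $\alpha_{\mathcal{S}}'$ is its derivative. *)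

theory Defs
  imports "HOL-Analysis.Analysis"
begin

definition B :: "nat \<Rightarrow> nat set \<Rightarrow> nat" where
  "B n S = card {P. partition_on {1..n} P \<and> (\<forall>b\<in>P. card b \<notin> S)}"

definition r :: "nat \<Rightarrow> real" where
  "r n = (THE x. x * exp x = real n)"

definition \<alpha> :: "nat set \<Rightarrow> 'a::real_normed_field \<Rightarrow> 'a" where
  "\<alpha> S z = (\<Sum>\<^sub>\<infinity>k\<in>S. z ^ k / fact k)"

lemma B_0: "B 0 S = 1"
proof -
  have "{P. partition_on {1..0::nat} P \<and> (\<forall>b\<in>P. card b \<notin> S)} = {{}}"
    by (auto simp: partition_on_empty)
  then show ?thesis by (simp add: B_def)
qed

lemma ex1_r:
  assumes "n \<ge> 1"
  shows "\<exists>!x::real. x * exp x = real n"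
proof -
  have "\<exists>x\<ge>0. x \<le> real n \<and> x * exp x = real n"
  proof (rule IVT')
    show "real n \<le> real n * exp (real n)" by (simp add: mult_le_cancel_left1)
  qed (auto intro!: continuous_intros)
  then obtain x where x: "x * exp x = real n" by blast
  moreover have "y = z" if "y * exp y = real n" "z * exp z = real n" for y z :: real
  proof -
    have strict: "a * exp a < b * exp b" if "0 < a" "a < b" for a b :: real
      using that by (intro mult_strict_mono) auto
    have "0 < y" "0 < z" using that assms
      by (metis exp_gt_zero of_nat_0_less_iff less_le_trans zero_less_mult_pos2 zero_less_one)+
    with that strict[of y z] strict[of z y] show ?thesis by (cases y z rule: linorder_cases) auto
  qed
  ultimately show ?thesis by blast
qed

lemma r_eq: "n \<ge> 1 \<Longrightarrow> r n * exp (r n) = real n"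
  unfolding r_def by (rule theI') (rule ex1_r)

lemma two_solutions:
  "\<exists>a b. a < b \<and> {x::real. 0 < x \<and> x * (1 - ln x) = 1 / 2} = {a, b}"
proof -
  define f where "f = (\<lambda>x::real. x * (1 - ln x))"
  have der: "(f has_real_derivative - ln x) (at x)" if "0 < x" for x
    unfolding f_def using that by (auto intro!: derivative_eq_intros)
  have cont: "continuous_on {u..v} f" if "0 < u" for u v
    unfolding f_def using that by (auto intro!: continuous_intros)
  have inc: "f x < f y" if "0 < x" "x < y" "y \<le> 1" for x y
  proof (rule DERIV_pos_imp_increasing_open[OF \<open>x < y\<close>])
    show "\<exists>d. (f has_real_derivative d) (at t) \<and> 0 < d" if "x < t" "t < y" for t
      using der[of t] that \<open>0 < x\<close> \<open>y \<le> 1\<close> by (intro exI[of _ "- ln t"]) auto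
  qed (use cont that in auto)
  have dec: "f y < f x" if "1 \<le> x" "x < y" for x y
  proof (rule DERIV_neg_imp_decreasing_open[OF \<open>x < y\<close>])
    show "\<exists>d. (f has_real_derivative d) (at t) \<and> d < 0" if "x < t" "t < y" for t
      using der[of t] that \<open>1 \<le> x\<close> by (intro exI[of _ "- ln t"]) auto
  qed (use cont that in auto)
  have f1: "f 1 = 1" and fe: "f (exp 1) = 0" by (simp_all add: f_def)
  have "(4::real) \<le> exp 2"
  proof -
    have "(2::real) * 2 \<le> exp 1 * exp 1"
      using exp_ge_add_one_self[of "1::real"] by (intro mult_mono) auto
    then show ?thesis by (simp flip: exp_add)
  qed
  then have "(16::real) \<le> exp 4"
    using mult_mono[of 4 "exp 2" 4 "exp (2::real)"] by (simp flip: exp_add)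
  then have f0: "f (exp (-4)) \<le> 1 / 2"
  proof -
    have "f (exp (-4)) = 5 / exp 4" by (simp add: f_def) (simp add: exp_minus divide_inverse)
    also have "\<dots> \<le> 5 / 16" using \<open>16 \<le> exp 4\<close> by (intro divide_left_mono) auto
    finally show ?thesis by simp
  qed
  obtain a where a: "exp (-4) \<le> a" "a \<le> 1" "f a = 1 / 2"
    using IVT'[of f "exp (-4)" "1 / 2" 1] f0 f1 cont by auto
  obtain b where b: "1 \<le> b" "b \<le> exp 1" "f b = 1 / 2"
    using IVT2'[of f "exp 1" "1 / 2" 1] f1 fe cont by auto
  have a0: "0 < a" using a(1) by (meson exp_gt_zero less_le_trans)
  have ab: "a < b" using a b f1 by (cases "a = 1") auto
  have "x = a \<or> x = b" if "0 < x" "f x = 1 / 2" for x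
  proof (cases "x \<le> 1")
    case True
    then show ?thesis using inc[of x a] inc[of a x] that a a0 by (cases x a rule: linorder_cases) auto
  next
    case False
    then show ?thesis using dec[of x b] dec[of b x] that b by (cases x b rule: linorder_cases) auto
  qed
  then have "{x. 0 < x \<and> f x = 1 / 2} = {a, b}" using a b a0 by auto
  with ab show ?thesis unfolding f_def by blast
qed

end

theory Submission
  imports Defs "HOL-Complex_Analysis.Complex_Analysis" "HOL-Probability.Distributions"
    "HOL-Real_Asymp.Real_Asymp"
begin

text \<open>
  The numbers \<open>B n S\<close> have exponential generating function \<open>exp (F z)\<close> with
  \<open>F z = exp z - 1 - \<alpha> S z\<close>, and Cauchy's formula on the circle of radius \<open>\<rho> = r n\<close> expresses
  \<open>B n S\<close> through the integral of \<open>exp (F (\<rho> * cis t) - F \<rho> - \<i> * n * t)\<close> over \<open>{-pi..pi}\<close>.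
  Since \<open>\<rho> * exp \<rho> = n\<close>, the point \<open>\<rho>\<close> is the saddle point for \<open>S = {}\<close>. For \<open>\<bar>t\<bar> \<le> 1 / (5 * \<rho>)\<close>
  the exponent is \<open>- \<sigma>\<^sup>2 * t\<^sup>2 / 2 + \<i> * c t + q t\<close> with \<open>\<sigma>\<^sup>2 = \<rho> * (\<rho> + 1) * exp \<rho>\<close>, where \<open>c t\<close> is real and
  collects the cubic term of \<open>exp\<close> and the linear term of \<open>\<alpha>\<close>. As only the real part of the integrand
  matters, \<open>c\<close> contributes only through \<open>c\<^sup>2\<close>, which together with \<open>q\<close> gives a relative error of order
  \<open>E = (1 + (\<alpha>' \<rho>)\<^sup>2) / exp \<rho>\<close>. Here \<open>\<alpha>'' \<rho> \<le> 4 * \<alpha>' \<rho> + 1\<close> absorbs the second derivative.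

  The gap condition on \<open>S\<close> enters through Chernoff bounds: a tail of the exponential series cut at
  \<open>\<delta> * \<rho>\<close> is at most \<open>exp (\<rho> * \<delta> * (1 - ln \<delta>)) \<le> exp (\<rho> / 2)\<close>. Hence \<open>\<alpha>\<close> is negligible against
  \<open>exp \<rho>\<close>, and the rest of the circle contributes a doubly exponentially small amount. The finitely
  many \<open>n\<close> with small \<open>r n\<close> only affect the constant.
\<close>

subsection \<open>Recurrence for partitions avoiding block sizes\<close>

text \<open>An arbitrary ground set replaces \<open>{1..n}\<close>, so that removing the block of a
  chosen point leaves an object of the same kind.\<close>

definition avoiding_partitions :: "'a set \<Rightarrow> nat set \<Rightarrow> 'a set set set" where
  "avoiding_partitions A S = {P. partition_on A P \<and> (\<forall>b\<in>P. card b \<notin> S)}"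

lemma finite_avoiding_partitions:
  "finite A \<Longrightarrow> finite (avoiding_partitions A S)"
  unfolding avoiding_partitions_def
  by (rule finite_subset[OF _ finitely_many_partition_on]) auto

text \<open>One inequality suffices: applied to a bijection and to its inverse it shows that the
  count depends only on the size of the ground set.\<close>

lemma card_avoiding_partitions_image_le:
  assumes "finite A" "inj_on f A"
  shows "card (avoiding_partitions A S) \<le> card (avoiding_partitions (f ` A) S)"
proof (rule card_inj_on_le[where f = "(`) ((`) f)"])
  have sub: "P \<subseteq> Pow A" if "P \<in> avoiding_partitions A S" for P
    using that by (auto simp: avoiding_partitions_def partition_on_def)
  show "inj_on ((`) ((`) f)) (avoiding_partitions A S)"
    by (rule inj_on_subset[OF inj_on_image_Pow[OF inj_on_image_Pow[OF assms(2)]]]) (use sub in auto)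
  show "(`) ((`) f) ` avoiding_partitions A S \<subseteq> avoiding_partitions (f ` A) S"
  proof clarify
    fix P assume P: "P \<in> avoiding_partitions A S"
    then have "partition_on A P" and no: "\<forall>b\<in>P. card b \<notin> S"
      by (auto simp: avoiding_partitions_def)
    then have "partition_on (f ` A) ((`) f ` P - {{}})"
      using partition_on_inj_image assms(2) by blast
    moreover have "{} \<notin> (`) f ` P"
      using \<open>partition_on A P\<close> by (auto simp: partition_on_def)
    moreover have "card (f ` b) = card b" if "b \<in> P" for b
      using sub[OF P] that assms(2) by (intro card_image) (auto intro: inj_on_subset)
    ultimately show "(`) f ` P \<in> avoiding_partitions (f ` A) S"
      using no by (auto simp: avoiding_partitions_def)
  qed
qed (use assms in \<open>auto intro: finite_avoiding_partitions\<close>)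

lemma card_avoiding_partitions:
  assumes "finite A"
  shows "card (avoiding_partitions A S) = B (card A) S"
proof -
  obtain f where f: "bij_betw f A {1..card A}"
    using ex_bij_betw_finite_nat[OF assms] bij_betw_iff_card[of A "{1..card A}"] assms by auto
  then have g: "bij_betw (inv_into A f) {1..card A} A"
    by (rule bij_betw_inv_into)
  have "card (avoiding_partitions A S) \<le> card (avoiding_partitions {1..card A} S)"
    using card_avoiding_partitions_image_le[OF assms, of f S] f by (simp add: bij_betw_def)
  moreover have "card (avoiding_partitions {1..card A} S) \<le> card (avoiding_partitions A S)"
    using card_avoiding_partitions_image_le[of "{1..card A}" "inv_into A f" S] g
    by (simp add: bij_betw_def)
  ultimately show ?thesis
    by (simp add: B_def avoiding_partitions_def)
qed

text \<open>Each partition is split at the block \<open>insert x X\<close> that contains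
  \<open>x\<close>. This block is the only one containing \<open>x\<close>, so the pair
  \<open>(X, P)\<close> can be recovered from the partition.\<close>

lemma card_avoiding_partitions_insert:
  assumes "finite A" "x \<notin> A"
  shows "card (avoiding_partitions (insert x A) S) =
    (\<Sum>X\<in>{X. X \<subseteq> A \<and> Suc (card X) \<notin> S}. card (avoiding_partitions (A - X) S))"
proof -
  let ?I = "{X. X \<subseteq> A \<and> Suc (card X) \<notin> S}"
  let ?T = "SIGMA X:?I. avoiding_partitions (A - X) S"
  let ?h = "\<lambda>(X, P). insert (insert x X) P"
  have finI: "finite ?I" using assms(1) by (auto intro: finite_subset[OF _ finite_Pow_iff[THEN iffD2]])
  have x_notin: "x \<notin> \<Union>P" if "P \<in> avoiding_partitions (A - X) S" for P X
    using that assms by (auto simp: avoiding_partitions_def partition_on_def)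
  have disj: "disjnt (insert x X) (\<Union>P)" if "P \<in> avoiding_partitions (A - X) S" for P X
    using that assms by (auto simp: avoiding_partitions_def partition_on_def disjnt_def)
  have "bij_betw ?h ?T (avoiding_partitions (insert x A) S)"
  proof (rule bij_betw_imageI)
    show "inj_on ?h ?T"
    proof (rule inj_onI)
      fix p p' assume "p \<in> ?T" "p' \<in> ?T" and eqh: "?h p = ?h p'"
      obtain X P X' P' where p: "p = (X, P)" "p' = (X', P')" by (metis surj_pair)
      have X: "X \<subseteq> A" "X' \<subseteq> A"
        and P: "P \<in> avoiding_partitions (A - X) S" "P' \<in> avoiding_partitions (A - X') S"
        and eq: "insert (insert x X) P = insert (insert x X') P'"
        using \<open>p \<in> ?T\<close> \<open>p' \<in> ?T\<close> eqh unfolding p by simp_all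
      have 1: "insert x X = insert x X'"
      proof -
        have "insert x X \<in> insert (insert x X') P'" using eq by (metis insertI1)
        then show ?thesis using x_notin[OF P(2)] by (metis UnionI insertE insertI1)
      qed
      then have "X = X'" using X assms by (metis insert_ident subsetD)
      moreover have "insert x X \<notin> P" "insert x X' \<notin> P'"
        using x_notin[OF P(1)] x_notin[OF P(2)] by (metis UnionI insertI1)+
      ultimately show "p = p'" unfolding p using eq 1 by (metis insert_ident)
    qed
    show "?h ` ?T = avoiding_partitions (insert x A) S"
    proof (intro equalityI subsetI)
      fix Q assume "Q \<in> ?h ` ?T"
      then obtain X P where Q: "Q = insert (insert x X) P" and X: "X \<subseteq> A" "Suc (card X) \<notin> S"
        and P: "P \<in> avoiding_partitions (A - X) S" by auto
      have "finite X" "x \<notin> X" using X assms by (auto intro: finite_subset)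
      then have c: "card (insert x X) \<notin> S" using X by simp
      have "insert x A - insert x X = A - X" using assms by auto
      moreover have "partition_on (A - X) P" using P by (simp add: avoiding_partitions_def)
      moreover have "insert x X \<subseteq> insert x A" "insert x X \<noteq> {}" using X by auto
      ultimately have "partition_on (insert x A) Q"
        unfolding Q using partition_on_insert[OF disj[OF P], of "insert x A"] by metis
      moreover have "\<forall>b\<in>Q. card b \<notin> S"
        using c P unfolding Q avoiding_partitions_def by blast
      ultimately show "Q \<in> avoiding_partitions (insert x A) S"
        by (simp add: avoiding_partitions_def)
    next
      fix Q assume Q: "Q \<in> avoiding_partitions (insert x A) S"
      then have pQ: "partition_on (insert x A) Q" by (simp add: avoiding_partitions_def)
      have UQ: "\<Union>Q = insert x A" using partition_onD1[OF pQ] by simp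
      then obtain b where b: "b \<in> Q" "x \<in> b" by (metis UnionE insertI1)
      define X where "X = b - {x}"
      define P where "P = Q - {b}"
      have bX: "b = insert x X" using b by (auto simp: X_def)
      have bsub: "b \<subseteq> insert x A" using UQ b by auto
      then have XA: "X \<subseteq> A" by (auto simp: X_def)
      have "finite X" using XA assms finite_subset by blast
      then have "card b = Suc (card X)" using card_Suc_Diff1[of b x] b(2) by (simp add: X_def)
      moreover have "card b \<notin> S" using Q b by (auto simp: avoiding_partitions_def)
      ultimately have X: "X \<in> ?I" using XA by simp
      have QP: "Q = insert b P" using b by (auto simp: P_def)
      have "disjnt b (\<Union>P)"
        using partition_onD2[OF pQ] b(1) unfolding P_def disjoint_def disjnt_def by auto
      then have "partition_on (insert x A - b) P"
        using pQ partition_on_insert[of b P "insert x A"] unfolding QP by simp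
      moreover have "insert x A - b = A - X" using assms b by (auto simp: X_def)
      ultimately have "P \<in> avoiding_partitions (A - X) S"
        using Q by (auto simp: avoiding_partitions_def P_def)
      then show "Q \<in> ?h ` ?T" using X QP bX by (intro image_eqI[of _ _ "(X, P)"]) auto
    qed
  qed
  then have "card (avoiding_partitions (insert x A) S) = card ?T"
    by (simp add: bij_betw_same_card)
  also have "\<dots> = (\<Sum>X\<in>?I. card (avoiding_partitions (A - X) S))"
    using finI assms by (intro card_SigmaI) (auto intro!: finite_avoiding_partitions)
  finally show ?thesis .
qed

text \<open>The block of \<open>Suc n\<close> has \<open>Suc k\<close> elements, and its other
  \<open>k\<close> elements are chosen among \<open>n\<close>. The binomial form is what Leibniz'
  rule reproduces for the generating function.\<close>

lemma B_Suc:
  "B (Suc n) S = (\<Sum>k\<le>n. (n choose k) * (if Suc k \<in> S then 0 else B (n - k) S))"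
proof -
  let ?A = "{1..n}"
  let ?f = "\<lambda>k. if Suc k \<in> S then 0 else B (n - k) S"
  have "B (Suc n) S = card (avoiding_partitions (insert (Suc n) ?A) S)"
    by (subst card_avoiding_partitions) auto
  also have "\<dots> = (\<Sum>X\<in>{X. X \<subseteq> ?A \<and> Suc (card X) \<notin> S}. card (avoiding_partitions (?A - X) S))"
    by (rule card_avoiding_partitions_insert) auto
  also have "\<dots> = (\<Sum>X\<in>{X. X \<subseteq> ?A \<and> Suc (card X) \<notin> S}. ?f (card X))"
    by (rule sum.cong[OF refl]) (auto simp: card_avoiding_partitions card_Diff_subset finite_subset)
  also have "\<dots> = (\<Sum>X\<in>Pow ?A. ?f (card X))"
    by (rule sum.mono_neutral_left) auto
  also have "\<dots> = (\<Sum>k\<le>n. \<Sum>X\<in>{X\<in>Pow ?A. card X = k}. ?f (card X))"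
    by (rule sum.group[symmetric]) (auto dest: card_mono[rotated])
  also have "\<dots> = (\<Sum>k\<le>n. (n choose k) * ?f k)"
  proof (rule sum.cong[OF refl])
    fix k
    have "{X \<in> Pow ?A. card X = k} = {X. X \<subseteq> ?A \<and> card X = k}" by auto
    then show "(\<Sum>X\<in>{X\<in>Pow ?A. card X = k}. ?f (card X)) = (n choose k) * ?f k"
      using n_subsets[of ?A k] by simp
  qed
  finally show ?thesis .
qed

subsection \<open>The partial exponential series\<close>

text \<open>Extending the coefficients by zero turns the unordered sum over \<open>S\<close> into an
  ordinary power series, to which termwise differentiation and comparison apply.\<close>

definition \<alpha>_coeff :: "nat set \<Rightarrow> nat \<Rightarrow> 'a::real_normed_field" where
  "\<alpha>_coeff S k = (if k \<in> S then 1 / fact k else 0)"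

lemma summable_norm_\<alpha>:
  fixes z :: "'a::{real_normed_field,banach}"
  shows "summable (\<lambda>k. norm (\<alpha>_coeff S k * z ^ k))"
proof (rule summable_comparison_test'[OF summable_norm_exp[of z], of 0])
  show "norm (norm (\<alpha>_coeff S n * z ^ n)) \<le> norm (z ^ n /\<^sub>R fact n)" for n
    by (simp add: \<alpha>_coeff_def norm_mult norm_power norm_divide norm_inverse divide_inverse)
qed

lemma \<alpha>_sums:
  fixes z :: "'a::{real_normed_field,banach}"
  shows "(\<lambda>k. \<alpha>_coeff S k * z ^ k) sums \<alpha> S z"
proof -
  have sums: "(\<lambda>k. \<alpha>_coeff S k * z ^ k) sums (\<Sum>k. \<alpha>_coeff S k * z ^ k)"
    by (rule summable_sums[OF summable_norm_cancel[OF summable_norm_\<alpha>]])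
  then have "((\<lambda>k. \<alpha>_coeff S k * z ^ k) has_sum (\<Sum>k. \<alpha>_coeff S k * z ^ k)) UNIV"
    using summable_norm_\<alpha> by (intro norm_summable_imp_has_sum)
  then have "((\<lambda>k. z ^ k / fact k) has_sum (\<Sum>k. \<alpha>_coeff S k * z ^ k)) S"
    by (subst (asm) has_sum_cong_neutral[where T = S and g = "\<lambda>k. z ^ k / fact k"])
       (auto simp: \<alpha>_coeff_def)
  then have "\<alpha> S z = (\<Sum>k. \<alpha>_coeff S k * z ^ k)"
    unfolding \<alpha>_def by (rule infsumI)
  with sums show ?thesis by simp
qed

lemma summable_\<alpha>:
  fixes z :: "'a::{real_normed_field,banach}"
  shows "summable (\<lambda>k. \<alpha>_coeff S k * z ^ k)"
  using \<alpha>_sums sums_summable by blast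

lemma \<alpha>_eq_suminf:
  fixes z :: "'a::{real_normed_field,banach}"
  shows "\<alpha> S z = (\<Sum>k. \<alpha>_coeff S k * z ^ k)"
  using \<alpha>_sums sums_unique by blast

text \<open>Since \<open>k / fact k = 1 / fact (k - 1)\<close> for positive \<open>k\<close>,
  differentiation only shifts the index set. All derivatives thus remain partial exponential
  series.\<close>

lemma has_field_derivative_\<alpha>:
  fixes z :: "'a::{real_normed_field,banach}"
  shows "(\<alpha> S has_field_derivative \<alpha> {k. Suc k \<in> S} z) (at z)"
proof -
  have "diffs (\<alpha>_coeff S) = (\<alpha>_coeff {k. Suc k \<in> S} :: nat \<Rightarrow> 'a)"
    unfolding diffs_def \<alpha>_coeff_def by (rule ext) (auto simp: fact_Suc field_simps simp del: of_nat_Suc)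
  then show ?thesis
    using termdiffs_strong_converges_everywhere[of "\<alpha>_coeff S" z, OF summable_\<alpha>]
    by (simp add: \<alpha>_eq_suminf[abs_def])
qed

lemma deriv_\<alpha>:
  fixes z :: "'a::{real_normed_field,banach}"
  shows "deriv (\<alpha> S) z = \<alpha> {k. Suc k \<in> S} z"
  by (rule DERIV_imp_deriv has_field_derivative_\<alpha>)+

lemma has_field_derivative_\<alpha>_compose [derivative_intros]:
  fixes f :: "'a \<Rightarrow> 'a::{real_normed_field,banach}"
  assumes "(f has_field_derivative f') (at x within A)"
  shows "((\<lambda>x. \<alpha> S (f x)) has_field_derivative \<alpha> {k. Suc k \<in> S} (f x) * f') (at x within A)"
  using DERIV_chain2[OF has_field_derivative_\<alpha> assms] .

lemma \<alpha>_0: "\<alpha> S (0 :: 'a::{real_normed_field,banach}) = (if 0 \<in> S then 1 else 0)"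
  using powser_zero[of "\<alpha>_coeff S :: nat \<Rightarrow> 'a"] by (simp add: \<alpha>_eq_suminf \<alpha>_coeff_def)

lemma \<alpha>_nonneg: "x \<ge> 0 \<Longrightarrow> \<alpha> S (x::real) \<ge> 0"
  unfolding \<alpha>_eq_suminf by (rule suminf_nonneg[OF summable_\<alpha>]) (simp add: \<alpha>_coeff_def)

lemma \<alpha>_mono: "S \<subseteq> T \<Longrightarrow> x \<ge> 0 \<Longrightarrow> \<alpha> S (x::real) \<le> \<alpha> T x"
  unfolding \<alpha>_eq_suminf
  by (rule suminf_le[OF _ summable_\<alpha> summable_\<alpha>]) (auto simp: \<alpha>_coeff_def)

lemma \<alpha>_Un_le:
  assumes "x \<ge> 0"
  shows "\<alpha> (S \<union> T) (x::real) \<le> \<alpha> S x + \<alpha> T x"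
  unfolding \<alpha>_eq_suminf suminf_add[OF summable_\<alpha> summable_\<alpha>]
  by (rule suminf_le[OF _ summable_\<alpha> summable_add[OF summable_\<alpha> summable_\<alpha>]])
     (use assms in \<open>auto simp: \<alpha>_coeff_def\<close>)

lemma norm_\<alpha>_le:
  fixes z :: "'a::{real_normed_field,banach}"
  shows "norm (\<alpha> S z) \<le> \<alpha> S (norm z)"
proof -
  have eq: "norm (\<alpha>_coeff S k * z ^ k) = \<alpha>_coeff S k * norm z ^ k" for k
    by (simp add: \<alpha>_coeff_def norm_mult norm_power norm_divide)
  have "norm (\<Sum>k. \<alpha>_coeff S k * z ^ k) \<le> (\<Sum>k. norm (\<alpha>_coeff S k * z ^ k))"
    by (rule summable_norm[OF summable_norm_\<alpha>])
  then show ?thesis unfolding \<alpha>_eq_suminf eq .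
qed

lemma \<alpha>_of_real: "\<alpha> S (of_real x :: complex) = of_real (\<alpha> S x)"
proof -
  have "(\<lambda>k. of_real (\<alpha>_coeff S k * x ^ k) :: complex) sums of_real (\<alpha> S x)"
    using \<alpha>_sums[of S x] by (simp only: sums_of_real_iff)
  moreover have "(\<lambda>k. of_real (\<alpha>_coeff S k * x ^ k)) = (\<lambda>k. \<alpha>_coeff S k * (of_real x :: complex) ^ k)"
    by (auto simp: \<alpha>_coeff_def)
  ultimately show ?thesis using \<alpha>_sums[of S "of_real x :: complex"] sums_unique2 by fastforce
qed

text \<open>For \<open>k\<close> in \<open>T\<close> the factor \<open>x powr (k - y)\<close> is at
  least 1, and inserting it gives a full exponential series in \<open>\<rho> * x\<close>. The form
  of the last hypothesis covers lower tails (\<open>x \<le> 1\<close>, \<open>k \<le> y\<close>) and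
  upper tails (\<open>x \<ge> 1\<close>, \<open>k \<ge> y\<close>) alike.\<close>

lemma \<alpha>_chernoff:
  fixes \<rho> x y :: real
  assumes "\<rho> \<ge> 0" "x > 0" and le: "\<And>k. k \<in> T \<Longrightarrow> x powr y \<le> x powr k"
  shows "\<alpha> T \<rho> \<le> x powr (-y) * exp (\<rho> * x)"
proof (rule sums_le[OF _ \<alpha>_sums])
  show "(\<lambda>k. x powr (-y) * ((\<rho> * x) ^ k /\<^sub>R fact k)) sums (x powr (-y) * exp (\<rho> * x))"
    by (intro sums_mult exp_converges)
  show "\<alpha>_coeff T k * \<rho> ^ k \<le> x powr (-y) * ((\<rho> * x) ^ k /\<^sub>R fact k)" for k
  proof (cases "k \<in> T")
    case True
    have "1 \<le> x powr (-y) * x ^ k"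
      using le[OF True] \<open>x > 0\<close> by (simp add: powr_minus powr_realpow field_simps)
    then have "\<rho> ^ k * 1 \<le> \<rho> ^ k * (x powr (-y) * x ^ k)"
      using assms by (intro mult_left_mono) auto
    then show ?thesis
      using True by (simp add: \<alpha>_coeff_def power_mult_distrib field_simps)
  qed (use assms in \<open>simp add: \<alpha>_coeff_def\<close>)
qed

lemma \<alpha>_le_exp: "x \<ge> 0 \<Longrightarrow> \<alpha> S (x::real) \<le> exp x"
  using \<alpha>_chernoff[of x 1 S 0] by simp

text \<open>For \<open>k \<le> 3 * \<rho>\<close> consecutive terms of the exponential series have
  ratio \<open>(k + 1) / \<rho> \<le> 4\<close>; the terms with \<open>k \<ge> 3 * \<rho>\<close>
  contribute at most 1 because \<open>exp 1 \<le> 3\<close>. Used to bound the second derivative of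
  \<alpha> by the first.\<close>

lemma \<alpha>_shift_le:
  fixes \<rho> :: real
  assumes "\<rho> \<ge> 1"
  shows "\<alpha> {k. Suc k \<in> T} \<rho> \<le> 4 * \<alpha> T \<rho> + 1"
proof -
  let ?L = "{k. Suc k \<in> T \<and> real k \<le> 3 * \<rho>}" and ?H = "{k. real k \<ge> 3 * \<rho>}"
  have "\<alpha> {k. Suc k \<in> T} \<rho> \<le> \<alpha> (?L \<union> ?H) \<rho>"
    using assms by (intro \<alpha>_mono) auto
  also have "\<dots> \<le> \<alpha> ?L \<rho> + \<alpha> ?H \<rho>"
    using assms by (intro \<alpha>_Un_le) auto
  also have "\<alpha> ?H \<rho> \<le> exp 1 powr (- (3 * \<rho>)) * exp (\<rho> * exp 1)"
    using assms by (intro \<alpha>_chernoff) (auto simp: powr_def)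
  also have "\<dots> = exp (\<rho> * (exp 1 - 3))"
    by (simp add: powr_def algebra_simps flip: exp_add)
  also have "\<dots> \<le> 1"
    using assms exp_le by (simp add: mult_le_0_iff)
  also have "\<alpha> ?L \<rho> \<le> 4 * \<alpha> T \<rho>"
  proof (rule sums_le[OF _ \<alpha>_sums])
    have "(\<lambda>k. \<alpha>_coeff T (Suc k) * \<rho> ^ Suc k) sums (\<alpha> T \<rho> - \<alpha>_coeff T 0)"
      using \<alpha>_sums[of T \<rho>] by (subst sums_Suc_iff) simp
    \<comment> \<open>The shift to \<open>Suc k\<close> loses the term of index 0; putting it back
      at \<open>k = 0\<close> makes the sum exactly \<open>4 * \<alpha> T \<rho>\<close>.\<close>
    then show "(\<lambda>k. 4 * (\<alpha>_coeff T (Suc k) * \<rho> ^ Suc k) + (if k = 0 then 4 * \<alpha>_coeff T 0 else 0)) sums (4 * \<alpha> T \<rho>)"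
      using sums_add[OF sums_mult[of _ _ 4] sums_single[of 0 "\<lambda>_. 4 * \<alpha>_coeff T 0"]] by fastforce
    show "\<alpha>_coeff ?L k * \<rho> ^ k \<le> 4 * (\<alpha>_coeff T (Suc k) * \<rho> ^ Suc k) + (if k = 0 then 4 * \<alpha>_coeff T 0 else 0)" for k
    proof (cases "k \<in> ?L")
      case True
      then have "real (Suc k) \<le> 4 * \<rho>" using assms by auto
      then have "\<rho> ^ k * real (Suc k) \<le> \<rho> ^ k * (4 * \<rho>)"
        using assms by (intro mult_left_mono) auto
      then have "\<alpha>_coeff ?L k * \<rho> ^ k \<le> 4 * (\<alpha>_coeff T (Suc k) * \<rho> ^ Suc k)"
        using True by (simp add: \<alpha>_coeff_def fact_Suc field_simps del: of_nat_Suc)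
      moreover have "0 \<le> (if k = 0 then 4 * \<alpha>_coeff T 0 else 0 :: real)"
        by (simp add: \<alpha>_coeff_def)
      ultimately show ?thesis by linarith
    next
      case False
      then have "\<alpha>_coeff ?L k = (0::real)" by (simp add: \<alpha>_coeff_def)
      then show ?thesis using assms by (simp add: \<alpha>_coeff_def)
    qed
  qed
  finally show ?thesis by simp
qed

subsection \<open>Generating function and Cauchy integral\<close>

definition egf :: "nat set \<Rightarrow> complex \<Rightarrow> complex" where
  "egf S z = exp (exp z - 1 - \<alpha> S z)"

lemma has_field_derivative_egf:
  "(egf S has_field_derivative (exp z - \<alpha> {k. Suc k \<in> S} z) * egf S z) (at z)"
  unfolding egf_def[abs_def] by (auto intro!: derivative_eq_intros)

lemma holomorphic_egf: "egf S holomorphic_on A"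
  unfolding holomorphic_on_def field_differentiable_def
  using has_field_derivative_egf has_field_derivative_at_within by blast

lemma higher_deriv_exp_minus_\<alpha>:
  "(deriv ^^ k) (\<lambda>z::complex. exp z - \<alpha> T z) = (\<lambda>z. exp z - \<alpha> {j. j + k \<in> T} z)"
proof (induction k)
  case (Suc k)
  have "deriv (\<lambda>z::complex. exp z - \<alpha> {j. j + k \<in> T} z) z = exp z - \<alpha> {j. j + Suc k \<in> T} z" for z
    by (rule DERIV_imp_deriv) (auto intro!: derivative_eq_intros)
  then show ?case using Suc by auto
qed simp

text \<open>The exponential formula by induction: the derivative of \<open>egf S\<close> is
  \<open>egf S\<close> times \<open>exp z - \<alpha> {k. Suc k \<in> S} z\<close>, and the
  \<open>i\<close>-th derivative of that factor at 0 is 0 or 1 according to whether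
  \<open>Suc i\<close> lies in \<open>S\<close>. Leibniz' rule at 0 is then \<open>B_Suc\<close>. As
  \<open>0 \<notin> S\<close>, the initial value is 1.\<close>

lemma higher_deriv_egf:
  assumes "S \<subseteq> {1..}"
  shows "(deriv ^^ n) (egf S) 0 = of_nat (B n S)"
proof (induction n rule: less_induct)
  case (less n)
  show ?case
  proof (cases n)
    case 0
    have "0 \<notin> S" using assms by auto
    then show ?thesis using 0 by (simp add: egf_def \<alpha>_0 B_0)
  next
    case (Suc m)
    let ?T = "{k. Suc k \<in> S}"
    let ?h = "\<lambda>z::complex. exp z - \<alpha> ?T z"
    have "deriv (egf S) = (\<lambda>z. ?h z * egf S z)"
      using DERIV_imp_deriv[OF has_field_derivative_egf] by auto
    then have "(deriv ^^ n) (egf S) 0 = (deriv ^^ m) (\<lambda>z. ?h z * egf S z) 0"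
      by (simp add: Suc funpow_swap1)
    also have "\<dots> = (\<Sum>i = 0..m. of_nat (m choose i) * (deriv ^^ i) ?h 0 * (deriv ^^ (m - i)) (egf S) 0)"
    proof (rule higher_deriv_mult[of _ UNIV])
      show "?h holomorphic_on UNIV"
        by (rule holomorphic_onI)
           (auto simp: field_differentiable_def intro!: exI derivative_eq_intros)
    qed (auto simp: holomorphic_egf)
    also have "\<dots> = (\<Sum>i\<le>m. of_nat ((m choose i) * (if Suc i \<in> S then 0 else B (m - i) S)))"
      by (rule sum.cong) (auto simp: less.IH Suc higher_deriv_exp_minus_\<alpha> \<alpha>_0)
    finally show ?thesis by (simp add: B_Suc Suc)
  qed
qed

text \<open>Moves the upper half of the period to the left, which places the saddle point
  \<open>t = 0\<close> in the interior of the interval.\<close>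

lemma has_integral_periodic_2pi_shift:
  fixes f :: "real \<Rightarrow> 'a::banach"
  assumes per: "\<And>x. f (x + 2 * pi) = f x" and int: "(f has_integral I) {0..2 * pi}"
  shows "(f has_integral I) {-pi..pi}"
proof -
  have "f integrable_on {0..2 * pi}" using int by blast
  then have "f integrable_on {0..pi}" "f integrable_on {pi..2 * pi}"
    by (auto intro: integrable_subinterval_real)
  then obtain I1 I2 where I1: "(f has_integral I1) {0..pi}" and I2: "(f has_integral I2) {pi..2 * pi}"
    by blast
  have "(f has_integral (I1 + I2)) {0..2 * pi}"
    by (rule has_integral_combine[OF _ _ I1 I2]) auto
  then have I: "I = I2 + I1" using int has_integral_unique by (metis add.commute)
  have "f \<circ> (+) (2 * pi) = f" using per by (auto simp: add.commute)
  moreover have "((f \<circ> (+) (2 * pi)) has_integral I2) {-pi..0}"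
    by (subst has_integral_shift_Icc_real) (use I2 in simp)
  ultimately have "(f has_integral I2) {-pi..0}" by simp
  then show ?thesis unfolding I by (rule has_integral_combine[OF _ _ _ I1, rotated 2]) auto
qed

lemma B_eq_integral:
  assumes "S \<subseteq> {1..}" "\<rho> > 0"
  shows "((\<lambda>t. Re (egf S (\<rho> * cis t) * cis (- (real n * t)))) has_integral (2 * pi * \<rho> ^ n * B n S / fact n)) {-pi..pi}"
proof -
  let ?f = "\<lambda>t. egf S (\<rho> * cis t) * cis (- (real n * t))"
  have "((\<lambda>u. egf S u / (u - 0) ^ Suc n) has_contour_integral
      ((2 * pi * \<i>) / fact n * (deriv ^^ n) (egf S) 0)) (circlepath 0 \<rho>)"
    using assms holomorphic_egf
    by (intro Cauchy_has_contour_integral_higher_derivative_circlepath)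
       (auto intro: holomorphic_on_imp_continuous_on)
  then have "((\<lambda>t. egf S (\<rho> * cis t) / (\<rho> * cis t) ^ Suc n * \<rho> * \<i> * cis t) has_integral
       ((2 * pi * \<i>) / fact n * B n S)) {0..2 * pi}"
    using assms by (simp add: circlepath_def has_contour_integral_part_circlepath_iff higher_deriv_egf)
  \<comment> \<open>The factor \<open>\<rho> ^ n / \<i>\<close> clears what is left of the
    denominator once \<open>\<rho> * cis t\<close> from the path derivative has cancelled one of its
    \<open>Suc n\<close> powers.\<close>
  then have "((\<lambda>t. egf S (\<rho> * cis t) / (\<rho> * cis t) ^ Suc n * \<rho> * \<i> * cis t * (\<rho> ^ n / \<i>)) has_integral
       ((2 * pi * \<i>) / fact n * B n S * (\<rho> ^ n / \<i>))) {0..2 * pi}"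
    by (rule has_integral_mult_left)
  moreover have "egf S (\<rho> * cis t) / (\<rho> * cis t) ^ Suc n * \<rho> * \<i> * cis t * (\<rho> ^ n / \<i>) = ?f t" for t :: real
  proof -
    have "cis (- (real n * t)) = inverse (cis t ^ n)"
      unfolding Complex.DeMoivre cis_inverse ..
    then show ?thesis using assms
      by (simp add: field_simps power_mult_distrib)
  qed
  moreover have "(2 * pi * \<i>) / fact n * B n S * (\<rho> ^ n / \<i>) = of_real (2 * pi * \<rho> ^ n * B n S / fact n)"
    by (simp add: field_simps)
  ultimately have "(?f has_integral of_real (2 * pi * \<rho> ^ n * B n S / fact n)) {0..2 * pi}"
    by (simp only:)
  moreover have "?f (t + 2 * pi) = ?f t" for t :: real
  proof -
    have "cis (- (real n * (t + 2 * pi))) = cis (- (real n * t)) * cis (2 * pi * - of_nat n)"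
      by (simp add: cis_mult algebra_simps)
    also have "cis (2 * pi * - of_nat n) = 1" by (intro cis_multiple_2pi) auto
    moreover have "cis (t + 2 * pi) = cis t" by (simp flip: cis_mult)
    ultimately show ?thesis by simp
  qed
  ultimately have "(?f has_integral of_real (2 * pi * \<rho> ^ n * B n S / fact n)) {-pi..pi}"
    by (intro has_integral_periodic_2pi_shift)
  from has_integral_Re[OF this] show ?thesis by (simp only: Re_complex_of_real)
qed

subsection \<open>Local expansion on the circle\<close>

lemma norm_exp_ii_Reals: "\<zeta> \<in> \<real> \<Longrightarrow> norm (exp (\<i> * \<zeta>)) = 1"
  by (auto elim!: Reals_cases)

text \<open>Third-order Taylor expansion in the angle. The fourth derivative is at most
  \<open>15 * \<rho> ^ 4 * exp \<rho>\<close>, and the remainder estimate divides by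
  \<open>fact 3\<close>, whence \<open>5 / 2\<close>.\<close>

lemma exp_circle_taylor:
  fixes \<rho> t :: real
  assumes "\<rho> \<ge> 1"
  shows "norm (exp (\<rho> * cis t) - exp \<rho> - \<i> * (\<rho> * exp \<rho> * t) + \<rho> * (\<rho> + 1) * exp \<rho> * t\<^sup>2 / 2
      + \<i> * ((\<rho> + 3 * \<rho>\<^sup>2 + \<rho> ^ 3) * exp \<rho> * t ^ 3 / 6)) \<le> 5 / 2 * \<rho> ^ 4 * exp \<rho> * t ^ 4"
proof -
  \<comment> \<open>The angle is a complex variable because the Taylor theorem used is complex; it
    is applied on the convex set of reals, where \<open>y\<close> has norm
    \<open>\<rho>\<close>.\<close>
  define y where "y = (\<lambda>\<zeta>::complex. of_real \<rho> * exp (\<i> * \<zeta>))"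
  \<comment> \<open>Up to powers of \<open>\<i>\<close>, the \<open>j\<close>-th derivative of
    \<open>exp (y \<zeta>)\<close> has the Stirling numbers of the second kind as coefficients: 1,
    1; 1, 3, 1; 1, 7, 6, 1. The last row sums to 15.\<close>
  define f :: "nat \<Rightarrow> complex \<Rightarrow> complex" where "f = (\<lambda>j \<zeta>. exp (y \<zeta>) *
    (if j = 0 then 1 else if j = 1 then \<i> * y \<zeta> else if j = 2 then - (y \<zeta> + y \<zeta> ^ 2)
     else if j = 3 then - \<i> * (y \<zeta> + 3 * y \<zeta> ^ 2 + y \<zeta> ^ 3)
     else y \<zeta> + 7 * y \<zeta> ^ 2 + 6 * y \<zeta> ^ 3 + y \<zeta> ^ 4))"
  have y': "(y has_field_derivative \<i> * y \<zeta>) (at \<zeta> within A)" for \<zeta> A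
    unfolding y_def by (auto intro!: derivative_eq_intros)
  have ny: "norm (y \<zeta>) = \<rho>" if "\<zeta> \<in> \<real>" for \<zeta>
    using norm_exp_ii_Reals[OF that] assms by (simp add: y_def norm_mult)
  have "norm (f 0 (of_real t) - (\<Sum>i\<le>3. f i 0 * (of_real t - 0) ^ i / fact i))
      \<le> (15 * \<rho> ^ 4 * exp \<rho>) * norm (of_real t - 0 :: complex) ^ Suc 3 / fact 3"
  proof (rule complex_Taylor[of "\<real>"])
    show "convex (\<real> :: complex set)" by (rule convex_Reals)
    show "(f i has_field_derivative f (Suc i) \<zeta>) (at \<zeta> within \<real>)" if "i \<le> 3" for i \<zeta>
    proof -
      have "i = 0 \<or> i = 1 \<or> i = 2 \<or> i = 3" using that by linarith
      then show ?thesis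
        by (elim disjE; simp add: f_def)
           (auto intro!: derivative_eq_intros y' simp: algebra_simps power2_eq_square power3_eq_cube power4_eq_xxxx)
    qed
    show "norm (f (Suc 3) \<zeta>) \<le> 15 * \<rho> ^ 4 * exp \<rho>" if "\<zeta> \<in> \<real>" for \<zeta>
    proof -
      have "norm (y \<zeta> + 7 * y \<zeta> ^ 2 + 6 * y \<zeta> ^ 3 + y \<zeta> ^ 4) \<le> \<rho> + 7 * \<rho> ^ 2 + 6 * \<rho> ^ 3 + \<rho> ^ 4"
        by (intro norm_triangle_le add_mono) (simp_all add: norm_mult norm_power ny that)
      also have "\<dots> \<le> \<rho> ^ 4 + 7 * \<rho> ^ 4 + 6 * \<rho> ^ 4 + \<rho> ^ 4"
        using assms by (intro add_mono mult_left_mono power_increasing self_le_power) auto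
      finally have "norm (y \<zeta> + 7 * y \<zeta> ^ 2 + 6 * y \<zeta> ^ 3 + y \<zeta> ^ 4) \<le> 15 * \<rho> ^ 4" by simp
      moreover have "norm (exp (y \<zeta>)) \<le> exp \<rho>" using norm_exp[of "y \<zeta>"] ny that by simp
      ultimately have "norm (exp (y \<zeta>)) * norm (y \<zeta> + 7 * y \<zeta> ^ 2 + 6 * y \<zeta> ^ 3 + y \<zeta> ^ 4) \<le> exp \<rho> * (15 * \<rho> ^ 4)"
        by (intro mult_mono) auto
      then show ?thesis by (simp add: f_def norm_mult mult_ac)
    qed
  qed auto
  moreover have "f 0 (of_real t) - (\<Sum>i\<le>3. f i 0 * (of_real t - 0) ^ i / fact i) =
      exp (\<rho> * cis t) - exp \<rho> - \<i> * (\<rho> * exp \<rho> * t) + \<rho> * (\<rho> + 1) * exp \<rho> * t\<^sup>2 / 2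
      + \<i> * ((\<rho> + 3 * \<rho>\<^sup>2 + \<rho> ^ 3) * exp \<rho> * t ^ 3 / 6)"
    by (simp add: f_def y_def cis_conv_exp numeral_3_eq_3 fact_numeral exp_of_real) 
       (simp add: field_simps power2_eq_square power3_eq_cube)
  moreover have "(15 * \<rho> ^ 4 * exp \<rho>) * norm (of_real t - 0 :: complex) ^ Suc 3 / fact 3
      = 5 / 2 * \<rho> ^ 4 * exp \<rho> * t ^ 4"
    by (simp add: fact_numeral)
  ultimately show ?thesis by (simp only:)
qed

lemma \<alpha>_circle_taylor:
  fixes \<rho> t :: real and S :: "nat set"
  assumes "\<rho> \<ge> 0"
  defines "a1 \<equiv> \<alpha> {k. Suc k \<in> S} \<rho>" and "a2 \<equiv> \<alpha> {k. Suc (Suc k) \<in> S} \<rho>"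
  shows "norm (\<alpha> S (\<rho> * cis t) - \<alpha> S \<rho> - \<i> * (\<rho> * a1 * t)) \<le> (\<rho> * a1 + \<rho>\<^sup>2 * a2) * t\<^sup>2"
proof -
  define y where "y = (\<lambda>\<zeta>::complex. of_real \<rho> * exp (\<i> * \<zeta>))"
  let ?A1 = "\<alpha> {k. Suc k \<in> S} :: complex \<Rightarrow> complex" and ?A2 = "\<alpha> {k. Suc (Suc k) \<in> S} :: complex \<Rightarrow> complex"
  define f :: "nat \<Rightarrow> complex \<Rightarrow> complex" where "f = (\<lambda>j \<zeta>.
    if j = 0 then \<alpha> S (y \<zeta>) else if j = 1 then \<i> * y \<zeta> * ?A1 (y \<zeta>)
    else - (y \<zeta> * ?A1 (y \<zeta>) + y \<zeta> ^ 2 * ?A2 (y \<zeta>)))"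
  have y': "(y has_field_derivative \<i> * y \<zeta>) (at \<zeta> within A)" for \<zeta> A
    unfolding y_def by (auto intro!: derivative_eq_intros)
  have ny: "norm (y \<zeta>) = \<rho>" if "\<zeta> \<in> \<real>" for \<zeta>
    using norm_exp_ii_Reals[OF that] assms by (simp add: y_def norm_mult)
  have "norm (f 0 (of_real t) - (\<Sum>i\<le>1. f i 0 * (of_real t - 0) ^ i / fact i))
      \<le> (\<rho> * a1 + \<rho>\<^sup>2 * a2) * norm (of_real t - 0 :: complex) ^ Suc 1 / fact 1"
  proof (rule complex_Taylor[of "\<real>"])
    show "convex (\<real> :: complex set)" by (rule convex_Reals)
    show "(f i has_field_derivative f (Suc i) \<zeta>) (at \<zeta> within \<real>)" if "i \<le> 1" for i \<zeta>
    proof -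
      have "i = 0 \<or> i = 1" using that by linarith
      then show ?thesis
        by (elim disjE; simp add: f_def)
           (auto intro!: derivative_eq_intros y' simp: algebra_simps power2_eq_square)
    qed
    show "norm (f (Suc 1) \<zeta>) \<le> \<rho> * a1 + \<rho>\<^sup>2 * a2" if "\<zeta> \<in> \<real>" for \<zeta>
    proof -
      have "norm (?A1 (y \<zeta>)) \<le> a1" "norm (?A2 (y \<zeta>)) \<le> a2"
        using norm_\<alpha>_le[of _ "y \<zeta>"] by (simp_all add: ny that a1_def a2_def)
      then have "norm (y \<zeta> * ?A1 (y \<zeta>) + y \<zeta> ^ 2 * ?A2 (y \<zeta>)) \<le> \<rho> * a1 + \<rho>\<^sup>2 * a2"
        using assms(1) by (intro norm_triangle_le add_mono) (simp_all add: norm_mult norm_power ny that mult_left_mono)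
      moreover have "f (Suc 1) \<zeta> = - (y \<zeta> * ?A1 (y \<zeta>) + y \<zeta> ^ 2 * ?A2 (y \<zeta>))"
        by (simp add: f_def)
      ultimately show ?thesis by (simp only: norm_minus_cancel)
    qed
  qed auto
  moreover have "f 0 (of_real t) - (\<Sum>i\<le>1. f i 0 * (of_real t - 0) ^ i / fact i) =
      \<alpha> S (\<rho> * cis t) - \<alpha> S \<rho> - \<i> * (\<rho> * a1 * t)"
    by (simp add: f_def y_def cis_conv_exp a1_def \<alpha>_of_real)
  ultimately show ?thesis by (simp add: power2_eq_square)
qed

section \<open>Stability of a Gaussian factor under small perturbations of its exponent\<close>

lemma power_le_mult_exp:
  fixes x :: real
  assumes "x \<ge> 0" "k > 0"
  shows "x ^ k \<le> real k ^ k * exp x"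
proof -
  have "x / k \<le> exp (x / k)"
    using exp_ge_add_one_self[of "x / k"] by linarith
  then have "(x / k) ^ k \<le> exp (x / k) ^ k"
    using assms by (intro power_mono) auto
  also have "\<dots> = exp x" using assms by (simp flip: exp_of_nat_mult)
  finally show ?thesis using assms by (simp add: power_divide field_simps)
qed

text \<open>With \<open>w = \<i> * c + q\<close>, the linear term of \<open>exp w\<close> has real
  part \<open>Re q\<close>, so \<open>c\<close> enters only through the quadratic remainder. That
  remainder costs \<open>exp (U / 4)\<close>, powers of \<open>U\<close> cost another
  \<open>exp (U / 8)\<close>, and \<open>exp (- U / 8)\<close> is what survives of
  \<open>exp (- U / 2)\<close>.\<close>

lemma perturbed_gaussian_bound:
  fixes U c E :: real and q :: complex
  assumes "U \<ge> 0" "E \<ge> 0" and q1: "norm q \<le> U / 4" and q2: "norm q \<le> E * (5 / 2 * U\<^sup>2 + 4 * U)"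
    and c: "c\<^sup>2 \<le> 2 * E * (U + U ^ 3)"
  shows "\<bar>Re (exp (of_real (- U / 2) + \<i> * c + q)) - exp (- U / 2)\<bar> \<le> 80000 * E * exp (- U / 8)"
proof -
  define w where "w = \<i> * c + q"
  have "norm (exp w - (\<Sum>k\<le>1. w ^ k / fact k)) \<le> exp \<bar>Re w\<bar> * norm w ^ Suc 1 / fact 1"
    by (rule Taylor_exp)
  then have tay: "norm (exp w - 1 - w) \<le> exp \<bar>Re w\<bar> * (norm w)\<^sup>2"
    by (simp add: power2_eq_square diff_diff_eq)
  have Rew: "\<bar>Re w\<bar> \<le> norm q" by (simp add: w_def abs_Re_le_cmod)
  have "norm w \<le> \<bar>c\<bar> + norm q"
    unfolding w_def by (rule order_trans[OF norm_triangle_ineq]) (simp add: norm_mult)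
  then have "(norm w)\<^sup>2 \<le> (\<bar>c\<bar> + norm q)\<^sup>2" by (intro power_mono) auto
  also have "\<dots> \<le> 2 * c\<^sup>2 + 2 * (norm q)\<^sup>2"
    using sum_squares_bound[of "\<bar>c\<bar>" "norm q"] by (simp add: power2_sum)
  also have "(norm q)\<^sup>2 \<le> (U / 4) * (E * (5 / 2 * U\<^sup>2 + 4 * U))"
    unfolding power2_eq_square[of "norm q"] using q1 q2 assms(1) by (intro mult_mono) auto
  finally have nw: "(norm w)\<^sup>2 \<le> E * (4 * U + 2 * U\<^sup>2 + 21 / 4 * U ^ 3)"
    using c by (simp add: algebra_simps power2_eq_square power3_eq_cube)
  have "\<bar>Re (exp w) - 1\<bar> \<le> \<bar>Re (exp w - 1 - w)\<bar> + \<bar>Re w\<bar>" by simp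
  also have "\<dots> \<le> norm (exp w - 1 - w) + norm q"
    using Rew by (intro add_mono abs_Re_le_cmod)
  also have "\<dots> \<le> exp (U / 4) * (E * (4 * U + 2 * U\<^sup>2 + 21 / 4 * U ^ 3)) + exp (U / 4) * (E * (5 / 2 * U\<^sup>2 + 4 * U))"
  proof (intro add_mono)
    show "norm (exp w - 1 - w) \<le> exp (U / 4) * (E * (4 * U + 2 * U\<^sup>2 + 21 / 4 * U ^ 3))"
      using Rew q1 by (intro order_trans[OF tay] mult_mono nw) auto
    have "1 * (E * (5 / 2 * U\<^sup>2 + 4 * U)) \<le> exp (U / 4) * (E * (5 / 2 * U\<^sup>2 + 4 * U))"
      using assms by (intro mult_right_mono) auto
    then show "norm q \<le> exp (U / 4) * (E * (5 / 2 * U\<^sup>2 + 4 * U))" using q2 by simp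
  qed
  also have "\<dots> = exp (U / 4) * E * (8 * U + 9 / 2 * U\<^sup>2 + 21 / 4 * U ^ 3)"
    by (simp add: algebra_simps)
  also have "\<dots> \<le> exp (U / 4) * E * (80000 * exp (U / 8))"
  proof (intro mult_left_mono)
    \<comment> \<open>The constants are \<open>(8 * k) ^ k\<close> for \<open>k\<close> = 1, 2, 3;
      the weighted total is 73792, below 80000.\<close>
    have "U \<le> 8 * exp (U / 8)" "U\<^sup>2 \<le> 256 * exp (U / 8)" "U ^ 3 \<le> 13824 * exp (U / 8)"
      using power_le_mult_exp[of "U / 8" 1] power_le_mult_exp[of "U / 8" 2] power_le_mult_exp[of "U / 8" 3] assms(1)
      by (simp_all add: power_divide)
    then show "8 * U + 9 / 2 * U\<^sup>2 + 21 / 4 * U ^ 3 \<le> 80000 * exp (U / 8)"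
      using exp_gt_zero[of "U / 8"] by linarith
  qed (use assms in auto)
  also have "\<dots> = 80000 * E * (exp (U / 4) * exp (U / 8))" by simp
  also have "exp (U / 4) * exp (U / 8) = exp (3 * U / 8)" by (simp flip: exp_add)
  finally have *: "\<bar>Re (exp w) - 1\<bar> \<le> 80000 * E * exp (3 * U / 8)" .
  have "exp (of_real (- U / 2) + \<i> * c + q) = of_real (exp (- U / 2)) * exp w"
    unfolding w_def add.assoc exp_add by (simp only: exp_of_real)
  then have "Re (exp (of_real (- U / 2) + \<i> * c + q)) - exp (- U / 2) = exp (- U / 2) * (Re (exp w) - 1)"
    by (simp only: times_complex.sel Re_complex_of_real Im_complex_of_real) (simp add: algebra_simps)
  then have "\<bar>Re (exp (of_real (- U / 2) + \<i> * c + q)) - exp (- U / 2)\<bar> = exp (- U / 2) * \<bar>Re (exp w) - 1\<bar>"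
    by (simp only: abs_mult abs_exp_cancel)
  also have "\<dots> \<le> exp (- U / 2) * (80000 * E * exp (3 * U / 8))"
    using * by (intro mult_left_mono) auto
  also have "\<dots> = 80000 * E * exp (- U / 8)"
    by (simp add: mult_ac flip: exp_add)
  finally show ?thesis .
qed

text \<open>The exponent of the Cauchy integrand relative to its value at \<open>t = 0\<close>.
  Replacing \<open>n\<close> by \<open>\<rho> * exp \<rho>\<close> removes exactly the linear term
  of \<open>exp (\<rho> * cis t)\<close>.\<close>

definition log_ratio :: "nat set \<Rightarrow> real \<Rightarrow> real \<Rightarrow> complex" where
  "log_ratio S \<rho> t = (exp (\<rho> * cis t) - exp \<rho> - \<i> * (\<rho> * exp \<rho> * t)) - (\<alpha> S (\<rho> * cis t) - \<alpha> S \<rho>)"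

text \<open>Both Taylor expansions are sorted into a Gaussian exponent, a real odd part
  \<open>c\<close> multiplied by \<open>\<i>\<close>, and a remainder \<open>q\<close>, and then fed
  to \<open>perturbed_gaussian_bound\<close>.\<close>

lemma log_ratio_near:
  fixes \<rho> t :: real and S :: "nat set"
  defines "a1 \<equiv> \<alpha> {k. Suc k \<in> S} \<rho>"
  assumes \<rho>: "\<rho> \<ge> 1" and t: "\<bar>t\<bar> \<le> 1 / (5 * \<rho>)" and a1: "5 * a1 + 1 \<le> exp \<rho> / 8"
  shows "\<bar>Re (exp (log_ratio S \<rho> t)) - exp (- (\<rho> * (\<rho> + 1) * exp \<rho> * t\<^sup>2) / 2)\<bar>
    \<le> 80000 * ((1 + a1\<^sup>2) / exp \<rho>) * exp (- (\<rho> * (\<rho> + 1) * exp \<rho> * t\<^sup>2) / 8)"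
proof -
  define a2 where "a2 = \<alpha> {k. Suc (Suc k) \<in> S} \<rho>"
  define L where "L = exp \<rho>"
  define V where "V = \<rho>\<^sup>2 * L * t\<^sup>2"
  define U where "U = \<rho> * (\<rho> + 1) * L * t\<^sup>2"
  define E where "E = (1 + a1\<^sup>2) / L"
  define D where "D = \<rho> * a1 + \<rho>\<^sup>2 * a2"
  define b where "b = (\<rho> + 3 * \<rho>\<^sup>2 + \<rho> ^ 3) * L / 6"
  define q1 where "q1 = exp (\<rho> * cis t) - exp \<rho> - \<i> * (\<rho> * exp \<rho> * t) + \<rho> * (\<rho> + 1) * exp \<rho> * t\<^sup>2 / 2
      + \<i> * ((\<rho> + 3 * \<rho>\<^sup>2 + \<rho> ^ 3) * exp \<rho> * t ^ 3 / 6)"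
  define q2 where "q2 = \<alpha> S (\<rho> * cis t) - \<alpha> S \<rho> - \<i> * (\<rho> * a1 * t)"
  define q where "q = q1 - q2"
  define c where "c = - (\<rho> * a1 * t) - b * t ^ 3"
  have L: "L > 0" by (simp add: L_def)
  have E: "E \<ge> 0" "1 / L \<le> E" "a1\<^sup>2 / L \<le> E" using L by (auto simp: E_def field_simps)
  have V: "0 \<le> V" "V \<le> U"
    using \<rho> L by (auto simp: V_def U_def power2_eq_square intro!: mult_right_mono mult_left_mono)
  have a1_ge: "a1 \<ge> 0" unfolding a1_def using \<rho> by (intro \<alpha>_nonneg) auto
  have "a2 \<le> 4 * a1 + 1"
    using \<alpha>_shift_le[OF \<rho>, of "{k. Suc k \<in> S}"] by (simp add: a1_def a2_def)
  then have "\<rho>\<^sup>2 * a2 \<le> \<rho>\<^sup>2 * (4 * a1 + 1)" by (intro mult_left_mono) auto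
  moreover have "\<rho> * a1 \<le> \<rho>\<^sup>2 * a1"
    using \<rho> a1_ge by (intro mult_right_mono) (auto simp: power2_eq_square)
  ultimately have D: "D \<le> \<rho>\<^sup>2 * (5 * a1 + 1)" by (simp add: D_def algebra_simps)
  have D1: "D \<le> \<rho>\<^sup>2 * (L / 8)"
    using a1 by (intro order_trans[OF D] mult_left_mono) (auto simp: L_def)
  \<comment> \<open>Completing the square trades the linear growth in \<open>a1\<close> for the
    quadratic growth allowed by \<open>E\<close>.\<close>
  have "5 * a1 + 1 \<le> 4 * (1 + a1\<^sup>2)"
    using zero_le_power2[of "2 * a1 - 5 / 4"]
    by (simp add: power2_eq_square algebra_simps)
  then have D2: "D \<le> \<rho>\<^sup>2 * (4 * (E * L))"
    using L by (intro order_trans[OF D] mult_left_mono) (auto simp: E_def)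
  have "norm q1 \<le> 5 / 2 * \<rho> ^ 4 * L * t ^ 4"
    unfolding q1_def L_def by (rule exp_circle_taylor[OF \<rho>])
  moreover have "norm q2 \<le> D * t\<^sup>2"
    unfolding q2_def D_def a1_def a2_def using \<rho> by (intro \<alpha>_circle_taylor) auto
  ultimately have q: "norm q \<le> 5 / 2 * \<rho> ^ 4 * L * t ^ 4 + D * t\<^sup>2"
    unfolding q_def by (intro norm_triangle_le_diff) simp
  \<comment> \<open>Two readings of the quartic remainder: the first yields a bound proportional to
    \<open>E\<close>, the second a small multiple of \<open>V\<close> because
    \<open>\<rho> * \<bar>t\<bar> \<le> 1 / 5\<close>.\<close>
  have V2: "\<rho> ^ 4 * L * t ^ 4 = V\<^sup>2 / L" "\<rho> ^ 4 * L * t ^ 4 = (\<rho> * \<bar>t\<bar>)\<^sup>2 * V"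
    using L by (simp_all add: V_def field_simps power2_eq_square power4_eq_xxxx)
  have "\<rho> * \<bar>t\<bar> \<le> \<rho> * (1 / (5 * \<rho>))" using t \<rho> by (intro mult_left_mono) auto
  also have "\<dots> = 1 / 5" using \<rho> by simp
  finally have "(\<rho> * \<bar>t\<bar>)\<^sup>2 \<le> (1 / 5)\<^sup>2" using \<rho> by (intro power_mono) auto
  then have "(\<rho> * \<bar>t\<bar>)\<^sup>2 * V \<le> (1 / 5)\<^sup>2 * V" using V by (intro mult_right_mono)
  then have *: "\<rho> ^ 4 * L * t ^ 4 \<le> V / 25" unfolding V2(2) by (simp add: power2_eq_square)
  have D1': "D * t\<^sup>2 \<le> V / 8"
    using mult_right_mono[OF D1, of "t\<^sup>2"] by (simp add: V_def)
  have D2': "D * t\<^sup>2 \<le> 4 * E * V"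
    using mult_right_mono[OF D2, of "t\<^sup>2"] by (simp add: V_def mult_ac)
  \<comment> \<open>The quartic part gives \<open>V / 10\<close> and the \<alpha> part
    \<open>V / 8\<close>, together less than \<open>V / 4\<close>.\<close>
  have qa: "norm q \<le> U / 4" using q * D1' V by linarith
  have VU: "V\<^sup>2 \<le> U\<^sup>2" "V ^ 3 \<le> U ^ 3" using V by (auto intro: power_mono)
  have "V\<^sup>2 / L \<le> E * U\<^sup>2" using mult_mono[OF E(2) VU(1)] E by simp
  moreover have "4 * E * V \<le> 4 * E * U" using V E by (intro mult_left_mono) auto
  ultimately have qb: "norm q \<le> E * (5 / 2 * U\<^sup>2 + 4 * U)"
    using q D2' V2(1) by (simp add: algebra_simps)
  have "c\<^sup>2 \<le> 2 * (\<rho> * a1 * t)\<^sup>2 + 2 * (b * t ^ 3)\<^sup>2"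
    using zero_le_power2[of "\<rho> * a1 * t - b * t ^ 3"] unfolding c_def power2_eq_square by (simp add: algebra_simps)
  moreover have "(\<rho> * a1 * t)\<^sup>2 \<le> E * U"
  proof -
    have "(\<rho> * a1 * t)\<^sup>2 = a1\<^sup>2 / L * V" using L by (simp add: V_def power_mult_distrib)
    also have "\<dots> \<le> E * U" using E V L by (intro mult_mono) auto
    finally show ?thesis .
  qed
  moreover have "(b * t ^ 3)\<^sup>2 \<le> E * U ^ 3"
  proof -
    have "\<rho> + 3 * \<rho>\<^sup>2 + \<rho> ^ 3 \<le> \<rho> ^ 3 + 3 * \<rho> ^ 3 + \<rho> ^ 3"
      using \<rho> by (intro add_mono mult_left_mono power_increasing self_le_power) auto
    then have "(\<rho> + 3 * \<rho>\<^sup>2 + \<rho> ^ 3) * L \<le> 6 * \<rho> ^ 3 * L"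
      using \<rho> L zero_le_power[of \<rho> 3] by (intro mult_right_mono) linarith+
    then have "b \<le> \<rho> ^ 3 * L" by (simp add: b_def)
    moreover have "b \<ge> 0" using \<rho> L by (simp add: b_def)
    ultimately have "b\<^sup>2 \<le> (\<rho> ^ 3 * L)\<^sup>2" by (intro power_mono)
    then have "(b * t ^ 3)\<^sup>2 \<le> (\<rho> ^ 3 * L)\<^sup>2 * (t ^ 3)\<^sup>2"
      unfolding power_mult_distrib by (intro mult_right_mono) auto
    also have "\<dots> = 1 / L * V ^ 3" using L by (simp add: V_def field_simps power2_eq_square power3_eq_cube)
    also have "\<dots> \<le> E * U ^ 3" using E V L VU by (intro mult_mono) auto
    finally show ?thesis .
  qed
  ultimately have cb: "c\<^sup>2 \<le> 2 * E * (U + U ^ 3)" by (simp add: algebra_simps)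
  have "log_ratio S \<rho> t = of_real (- U / 2) + \<i> * c + q"
    unfolding log_ratio_def q_def q1_def q2_def c_def b_def U_def L_def
    by (simp add: exp_of_real \<alpha>_of_real field_simps)
  moreover have "\<bar>Re (exp (of_real (- U / 2) + \<i> * c + q)) - exp (- U / 2)\<bar> \<le> 80000 * E * exp (- U / 8)"
    using V by (intro perturbed_gaussian_bound E qa qb cb) auto
  ultimately show ?thesis by (simp only: U_def E_def L_def)
qed

section \<open>Decay of the integrand away from the saddle point\<close>

lemma cos_le_quadratic:
  fixes x :: real
  assumes "\<bar>x\<bar> \<le> 1"
  shows "cos x \<le> 1 - x\<^sup>2 / 4"
proof -
  obtain t where "cos x = (\<Sum>m<4. cos_coeff m * x ^ m) + cos (t + 1/2 * real 4 * pi) / fact 4 * x ^ 4"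
    using Maclaurin_cos_expansion[of x 4] by blast
  moreover have "(\<Sum>m<4. cos_coeff m * x ^ m) = 1 - x\<^sup>2 / 2"
    by (simp add: cos_coeff_def lessThan_nat_numeral fact_numeral)
  ultimately have "cos x = 1 - x\<^sup>2 / 2 + cos (t + 1/2 * real 4 * pi) * (x ^ 4 / 24)"
    by (simp add: fact_numeral)
  also have "\<dots> \<le> 1 - x\<^sup>2 / 2 + 1 * (x ^ 4 / 24)"
    by (intro add_left_mono mult_right_mono) auto
  also have "x ^ 4 \<le> x\<^sup>2"
    using power_decreasing[of 2 4 "\<bar>x\<bar>"] assms by simp
  finally show ?thesis using zero_le_power2[of x] by linarith
qed

text \<open>On this range \<open>\<rho> * cos t \<le> \<rho> - 1 / (100 * \<rho>)\<close>, since
  \<open>cos\<close> decreases on \<open>{0..pi}\<close> and is at most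
  \<open>1 - x\<^sup>2 / 4\<close> at \<open>x = 1 / (5 * \<rho>)\<close>. The two \<alpha> terms
  together add at most \<open>2 * \<alpha> S \<rho>\<close>.\<close>

lemma log_ratio_far:
  fixes \<rho> t :: real
  assumes \<rho>: "\<rho> \<ge> 1" and t: "1 / (5 * \<rho>) \<le> \<bar>t\<bar>" "\<bar>t\<bar> \<le> pi"
  shows "norm (exp (log_ratio S \<rho> t)) \<le> exp (- exp \<rho> * (1 - exp (- 1 / (100 * \<rho>))) + 2 * \<alpha> S \<rho>)"
proof -
  have "cos t = cos \<bar>t\<bar>" by simp
  also have "\<dots> \<le> cos (1 / (5 * \<rho>))" using \<rho> t by (intro cos_monotone_0_pi_le) auto
  also have "\<dots> \<le> 1 - (1 / (5 * \<rho>))\<^sup>2 / 4" using \<rho> by (intro cos_le_quadratic) auto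
  finally have "\<rho> * cos t \<le> \<rho> * (1 - (1 / (5 * \<rho>))\<^sup>2 / 4)" using \<rho> by (intro mult_left_mono) auto
  also have "\<dots> = \<rho> + - 1 / (100 * \<rho>)" using \<rho> by (simp add: field_simps power2_eq_square)
  finally have c: "exp (\<rho> * cos t) \<le> exp \<rho> * exp (- 1 / (100 * \<rho>))" by (simp only: exp_le_cancel_iff flip: exp_add)
  have "Re (exp (\<rho> * cis t)) \<le> exp (\<rho> * cos t)"
    using complex_Re_le_cmod[of "exp (\<rho> * cis t)"] by simp
  moreover have "- Re (\<alpha> S (\<rho> * cis t)) \<le> \<alpha> S \<rho>"
  proof -
    have "\<bar>Re (\<alpha> S (\<rho> * cis t))\<bar> \<le> norm (\<alpha> S (\<rho> * cis t))" by (rule abs_Re_le_cmod)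
    also have "\<dots> \<le> \<alpha> S (norm (\<rho> * cis t))" by (rule norm_\<alpha>_le)
    also have "norm (\<rho> * cis t) = \<rho>" using \<rho> by (simp add: norm_mult)
    finally show ?thesis by simp
  qed
  moreover have "Re (log_ratio S \<rho> t) = Re (exp (\<rho> * cis t)) - exp \<rho> - Re (\<alpha> S (\<rho> * cis t)) + \<alpha> S \<rho>"
    unfolding log_ratio_def by (simp add: \<alpha>_of_real exp_of_real)
  ultimately have "Re (log_ratio S \<rho> t) \<le> - exp \<rho> * (1 - exp (- 1 / (100 * \<rho>))) + 2 * \<alpha> S \<rho>"
    using c by (simp add: algebra_simps)
  then show ?thesis by (simp only: norm_exp_eq_Re exp_le_cancel_iff)
qed

subsection \<open>Comparison with a Gaussian integral\<close>

lemma gaussian_has_integral: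
  fixes c :: real
  assumes "c > 0"
  shows "((\<lambda>x. exp (- (c * x\<^sup>2) / 2)) has_integral sqrt (2 * pi / c)) UNIV"
proof -
  let ?d = "normal_density 0 (1 / sqrt c)"
  have "(?d has_integral 1) UNIV"
    using has_integral_integral_lborel[of ?d] assms by simp
  then have "((\<lambda>x. sqrt (2 * pi / c) * ?d x) has_integral sqrt (2 * pi / c) * 1) UNIV"
    by (rule has_integral_mult_right)
  moreover have "sqrt (2 * pi / c) * ?d x = exp (- (c * x\<^sup>2) / 2)" for x
    using assms by (simp add: normal_density_def power_divide field_simps)
  ultimately show ?thesis by simp
qed

text \<open>With \<open>h\<close> extended by zero to the whole line, its distance from the Gaussian
  is dominated everywhere by a wider Gaussian plus the constant \<open>T\<close> on
  \<open>{-pi..pi}\<close>. Thus no truncated Gaussian integral has to be evaluated.\<close>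

lemma integral_compare_gaussian:
  fixes h :: "real \<Rightarrow> real" and c D T I \<theta> :: real
  assumes int: "(h has_integral I) {-pi..pi}" and "c > 0" "\<theta> \<le> pi" "T \<ge> 0"
    and near: "\<And>t. \<bar>t\<bar> \<le> \<theta> \<Longrightarrow> \<bar>h t - exp (- (c * t\<^sup>2) / 2)\<bar> \<le> D * exp (- (c * t\<^sup>2) / 8)"
    and far: "\<And>t. \<theta> \<le> \<bar>t\<bar> \<Longrightarrow> \<bar>t\<bar> \<le> pi \<Longrightarrow> \<bar>h t\<bar> \<le> T"
    and tail: "\<And>t. \<theta> \<le> \<bar>t\<bar> \<Longrightarrow> exp (- (c * t\<^sup>2) / 2) \<le> D * exp (- (c * t\<^sup>2) / 8)"
  shows "\<bar>I - sqrt (2 * pi / c)\<bar> \<le> D * sqrt (8 * pi / c) + 2 * pi * T"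
proof -
  let ?g = "\<lambda>t. exp (- (c * t\<^sup>2) / 2)" and ?e = "\<lambda>t. exp (- (c * t\<^sup>2) / 8)"
  define f where "f = (\<lambda>t. (if t \<in> {-pi..pi} then h t else 0) - ?g t)"
  define u where "u = (\<lambda>t. D * ?e t + (if t \<in> {-pi..pi} then T else 0))"
  have f: "(f has_integral (I - sqrt (2 * pi / c))) UNIV"
    unfolding f_def using assms
    by (intro has_integral_diff gaussian_has_integral) (simp_all only: has_integral_restrict_UNIV)
  have T: "((\<lambda>_. T) has_integral (2 * pi * T)) {-pi..pi}"
    using has_integral_const_real[of T "-pi" pi] by simp
  \<comment> \<open>The wider Gaussian has parameter \<open>c / 4\<close>, which gives the
    \<open>8 * pi / c\<close> in the bound.\<close>
  have "((\<lambda>t. exp (- (c / 4 * t\<^sup>2) / 2)) has_integral sqrt (2 * pi / (c / 4))) UNIV"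
    using assms by (intro gaussian_has_integral) auto
  then have "(?e has_integral sqrt (8 * pi / c)) UNIV" by simp
  then have u: "(u has_integral (D * sqrt (8 * pi / c) + 2 * pi * T)) UNIV"
    unfolding u_def using T
    by (intro has_integral_add has_integral_mult_right) (simp_all only: has_integral_restrict_UNIV)
  have "norm (f t) \<le> u t" for t
  proof (cases "\<bar>t\<bar> \<le> \<theta>")
    case True
    then have "t \<in> {-pi..pi}" using \<open>\<theta> \<le> pi\<close> by auto
    then show ?thesis using near[OF True] \<open>T \<ge> 0\<close> by (simp add: f_def u_def)
  next
    case False
    then have g: "?g t \<le> D * ?e t" using tail[of t] by simp
    show ?thesis
    proof (cases "t \<in> {-pi..pi}")
      case True
      then have "\<bar>h t\<bar> \<le> T" using False by (intro far) auto
      moreover have "\<bar>h t - ?g t\<bar> \<le> \<bar>h t\<bar> + ?g t" by (smt (verit) exp_ge_zero)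
      ultimately show ?thesis using True g by (simp add: f_def u_def)
    next
      case False
      then show ?thesis using g by (auto simp: f_def u_def)
    qed
  qed
  then have "norm (integral UNIV f) \<le> integral UNIV u"
    using f u by (intro integral_norm_bound_integral) auto
  then show ?thesis using integral_unique[OF f] integral_unique[OF u] by simp
qed

text \<open>Here the exponent parameter \<open>U\<close> is at least \<open>exp \<rho> / 25\<close>,
  so the surplus factor \<open>exp (- (3 * U / 8))\<close>, being at most
  \<open>8 / (3 * U)\<close>, is of order \<open>1 / exp \<rho>\<close>.\<close>

lemma gaussian_tail:
  fixes \<rho> t E :: real
  assumes \<rho>: "\<rho> \<ge> 1" and t: "1 / (5 * \<rho>) \<le> \<bar>t\<bar>" and E: "1 / exp \<rho> \<le> E"
  shows "exp (- (\<rho> * (\<rho> + 1) * exp \<rho> * t\<^sup>2) / 2) \<le> 80000 * E * exp (- (\<rho> * (\<rho> + 1) * exp \<rho> * t\<^sup>2) / 8)"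
proof -
  define U where "U = \<rho> * (\<rho> + 1) * exp \<rho> * t\<^sup>2"
  have "(1 / (5 * \<rho>))\<^sup>2 \<le> \<bar>t\<bar>\<^sup>2" using t \<rho> by (intro power_mono) auto
  then have "\<rho> * \<rho> * exp \<rho> * (1 / (5 * \<rho>))\<^sup>2 \<le> \<rho> * (\<rho> + 1) * exp \<rho> * t\<^sup>2"
    using \<rho> by (intro mult_mono) auto
  then have U: "exp \<rho> / 25 \<le> U" using \<rho> by (simp add: U_def power2_eq_square field_simps)
  then have U0: "U > 0" using exp_gt_zero[of \<rho>] by linarith
  have "exp (- (3 * U / 8)) \<le> 1 / (3 * U / 8)"
    using exp_ge_add_one_self[of "3 * U / 8"] U0 
    unfolding exp_minus inverse_eq_divide by (intro divide_left_mono) (linarith | simp)+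
  also have "\<dots> \<le> 1 / (3 * (exp \<rho> / 25) / 8)" using U U0 by (intro divide_left_mono) auto
  also have "\<dots> \<le> 80000 * (1 / exp \<rho>)" by (simp add: field_simps)
  also have "\<dots> \<le> 80000 * E" using E by simp
  finally have "exp (- (3 * U / 8)) * exp (- U / 8) \<le> 80000 * E * exp (- U / 8)" by (intro mult_right_mono) auto
  moreover have "exp (- (3 * U / 8)) * exp (- U / 8) = exp (- U / 2)" by (simp flip: exp_add)
  ultimately show ?thesis by (simp only: U_def)
qed

lemma egf_eq_log_ratio:
  assumes "real n = \<rho> * exp \<rho>"
  shows "egf S (\<rho> * cis t) * cis (- (real n * t)) = of_real (exp (exp \<rho> - 1 - \<alpha> S \<rho>)) * exp (log_ratio S \<rho> t)"
  unfolding egf_def log_ratio_def assms cis_conv_exp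
  by (simp add: exp_of_real \<alpha>_of_real algebra_simps flip: exp_add exp_of_real)

text \<open>The normalised Cauchy integral \<open>I\<close> is compared with the Gaussian integral.
  The constant is 80000 times 2, the ratio of the two Gaussian integrals, plus 1 for the far part of
  the circle.\<close>

lemma B_saddle_point:
  fixes \<rho> :: real and S :: "nat set"
  defines "a1 \<equiv> \<alpha> {k. Suc k \<in> S} \<rho>"
  defines "T \<equiv> exp (- exp \<rho> * (1 - exp (- 1 / (100 * \<rho>))) + 2 * \<alpha> S \<rho>)"
  assumes S: "S \<subseteq> {1..}" and n: "real n = \<rho> * exp \<rho>" and \<rho>: "\<rho> \<ge> 1"
    and a1: "5 * a1 + 1 \<le> exp \<rho> / 8"
    and T: "T * sqrt (2 * pi * \<rho> * (\<rho> + 1) * exp \<rho>) \<le> exp (- \<rho>)"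
  shows "\<exists>\<epsilon>. real (B n S) = fact n * exp (exp \<rho> - 1 - \<alpha> S \<rho>)
            / (\<rho> ^ n * sqrt (2 * pi * \<rho> * (\<rho> + 1) * exp \<rho>)) * (1 + \<epsilon>)
      \<and> \<bar>\<epsilon>\<bar> \<le> 160001 * ((1 + a1\<^sup>2) / exp \<rho>)"
proof -
  define c where "c = \<rho> * (\<rho> + 1) * exp \<rho>"
  define E where "E = (1 + a1\<^sup>2) / exp \<rho>"
  define M where "M = exp (exp \<rho> - 1 - \<alpha> S \<rho>)"
  define I where "I = 2 * pi * \<rho> ^ n * B n S / fact n / M"
  have c: "c > 0" using \<rho> by (simp add: c_def)
  have M: "M > 0" by (simp add: M_def)
  have E: "E \<ge> 0" "1 / exp \<rho> \<le> E" by (auto simp: E_def field_simps)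
  have "((\<lambda>t. M * Re (exp (log_ratio S \<rho> t))) has_integral (2 * pi * \<rho> ^ n * B n S / fact n)) {-pi..pi}"
    using B_eq_integral[OF S, of \<rho> n] \<rho> unfolding egf_eq_log_ratio[OF n] M_def by simp
  then have "((\<lambda>t. M * Re (exp (log_ratio S \<rho> t)) / M) has_integral I) {-pi..pi}"
    unfolding I_def by (rule has_integral_divide)
  then have int: "((\<lambda>t. Re (exp (log_ratio S \<rho> t))) has_integral I) {-pi..pi}" using M by simp
  have "1 / (5 * \<rho>) \<le> 1" using \<rho> by simp
  then have th: "1 / (5 * \<rho>) \<le> pi" using pi_gt3 by linarith
  have main: "\<bar>I - sqrt (2 * pi / c)\<bar> \<le> (80000 * E) * sqrt (8 * pi / c) + 2 * pi * T"
  proof (rule integral_compare_gaussian[OF int c th])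
    show "\<bar>Re (exp (log_ratio S \<rho> t)) - exp (- (c * t\<^sup>2) / 2)\<bar> \<le> 80000 * E * exp (- (c * t\<^sup>2) / 8)"
      if "\<bar>t\<bar> \<le> 1 / (5 * \<rho>)" for t
      using log_ratio_near[OF \<rho> that] a1 by (simp add: c_def E_def a1_def)
    show "\<bar>Re (exp (log_ratio S \<rho> t))\<bar> \<le> T" if "1 / (5 * \<rho>) \<le> \<bar>t\<bar>" "\<bar>t\<bar> \<le> pi" for t
      unfolding T_def using log_ratio_far[OF \<rho> that] abs_Re_le_cmod by (rule order_trans[rotated])
    show "exp (- (c * t\<^sup>2) / 2) \<le> 80000 * E * exp (- (c * t\<^sup>2) / 8)" if "1 / (5 * \<rho>) \<le> \<bar>t\<bar>" for t
      unfolding c_def using \<rho> that E(2) by (rule gaussian_tail)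
  qed (use E in \<open>auto simp: T_def\<close>)
  \<comment> \<open>The reciprocal of the Gaussian integral, so that \<open>s * I\<close> is the
    ratio of \<open>B n S\<close> to its main term.\<close>
  define s where "s = sqrt (c / (2 * pi))"
  have s: "s > 0" using c by (simp add: s_def)
  have s1: "s * sqrt (2 * pi / c) = 1" and s2: "s * sqrt (8 * pi / c) = 2"
    and s3: "s * (2 * pi) = sqrt (2 * pi * c)"
    and s4: "s = sqrt (2 * pi * c) / (2 * pi)"
  proof -
    show "s * sqrt (2 * pi / c) = 1" unfolding s_def using c by (simp flip: real_sqrt_mult)
    have "s * sqrt (8 * pi / c) = sqrt (2\<^sup>2)" unfolding s_def using c by (simp flip: real_sqrt_mult)
    then show "s * sqrt (8 * pi / c) = 2" by simp
    have "s * (2 * pi) = sqrt (c / (2 * pi)) * sqrt ((2 * pi)\<^sup>2)"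
      by (subst real_sqrt_abs) (simp add: s_def)
    also have "\<dots> = sqrt (2 * pi * c)" unfolding real_sqrt_mult[symmetric] by (simp add: power2_eq_square)
    finally show s3: "s * (2 * pi) = sqrt (2 * pi * c)" .
    then show "s = sqrt (2 * pi * c) / (2 * pi)" by (simp add: field_simps)
  qed
  define \<epsilon> where "\<epsilon> = s * (I - sqrt (2 * pi / c))"
  have "\<bar>\<epsilon>\<bar> = s * \<bar>I - sqrt (2 * pi / c)\<bar>" using s by (simp add: \<epsilon>_def abs_mult)
  also have "\<dots> \<le> s * ((80000 * E) * sqrt (8 * pi / c) + 2 * pi * T)" using main s by (intro mult_left_mono) auto
  also have "\<dots> = 80000 * E * (s * sqrt (8 * pi / c)) + T * (s * (2 * pi))" by (simp add: algebra_simps)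
  also have "\<dots> = 160000 * E + T * sqrt (2 * pi * c)" unfolding s2 s3 by simp
  also have "T * sqrt (2 * pi * c) \<le> 1 / exp \<rho>" using T by (simp add: c_def mult_ac exp_minus inverse_eq_divide)
  also have "\<dots> \<le> E" by (rule E)
  finally have "\<bar>\<epsilon>\<bar> \<le> 160001 * E" by simp
  moreover have "1 + \<epsilon> = s * I" unfolding \<epsilon>_def using s1 by (simp add: right_diff_distrib)
  then have "fact n * M / (\<rho> ^ n * sqrt (2 * pi * c)) * (1 + \<epsilon>) = real (B n S)"
    unfolding s4 I_def using c M \<rho> by (simp add: field_simps)
  ultimately show ?thesis
    unfolding E_def M_def c_def by (intro exI[of _ \<epsilon>]) (simp add: mult_ac)
qed

text \<open>Chernoff's bound with the thresholds themselves as parameters has exponent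
  \<open>\<rho> * \<delta> * (1 - ln \<delta>)\<close>, at most \<open>\<rho> / 2\<close>. The shift
  \<open>j\<close> lets one statement serve \<alpha> (\<open>j = 0\<close>) and its derivative
  (\<open>j = 1\<close>); it affects only the upper tail.\<close>

lemma \<alpha>_le_exp_half:
  fixes \<rho> \<delta>\<^sub>1 \<delta>\<^sub>2 :: real and j :: nat
  assumes "\<rho> \<ge> 0" "0 < \<delta>\<^sub>1" "\<delta>\<^sub>1 \<le> 1" "1 \<le> \<delta>\<^sub>2"
    and f: "\<delta>\<^sub>1 * (1 - ln \<delta>\<^sub>1) \<le> 1 / 2" "\<delta>\<^sub>2 * (1 - ln \<delta>\<^sub>2) \<le> 1 / 2"
    and T: "\<And>k. k \<in> T \<Longrightarrow> real k \<le> \<delta>\<^sub>1 * \<rho> \<or> \<delta>\<^sub>2 * \<rho> \<le> real (k + j)"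
  shows "\<alpha> T \<rho> \<le> (1 + \<delta>\<^sub>2 ^ j) * exp (\<rho> / 2)"
proof -
  let ?L = "{k. real k \<le> \<delta>\<^sub>1 * \<rho>}" and ?H = "{k. \<delta>\<^sub>2 * \<rho> - real j \<le> real k}"
  have "\<alpha> T \<rho> \<le> \<alpha> (?L \<union> ?H) \<rho>"
    using assms(1) T by (intro \<alpha>_mono) fastforce+
  also have "\<dots> \<le> \<alpha> ?L \<rho> + \<alpha> ?H \<rho>" using assms(1) by (rule \<alpha>_Un_le)
  also have "\<alpha> ?L \<rho> \<le> \<delta>\<^sub>1 powr (- (\<delta>\<^sub>1 * \<rho>)) * exp (\<rho> * \<delta>\<^sub>1)"
    using assms by (intro \<alpha>_chernoff) (auto intro: powr_mono')
  also have "\<dots> = exp (\<rho> * (\<delta>\<^sub>1 * (1 - ln \<delta>\<^sub>1)))"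
    using assms by (simp add: powr_def algebra_simps flip: exp_add)
  also have "\<dots> \<le> exp (\<rho> * (1 / 2))"
    using mult_left_mono[OF f(1) assms(1)] by (simp only: exp_le_cancel_iff)
  also have "\<alpha> ?H \<rho> \<le> \<delta>\<^sub>2 powr (- (\<delta>\<^sub>2 * \<rho> - real j)) * exp (\<rho> * \<delta>\<^sub>2)"
    using assms by (intro \<alpha>_chernoff) (auto intro: powr_mono)
  also have "\<dots> = \<delta>\<^sub>2 ^ j * exp (\<rho> * (\<delta>\<^sub>2 * (1 - ln \<delta>\<^sub>2)))"
  proof -
    have "\<delta>\<^sub>2 powr (- (\<delta>\<^sub>2 * \<rho> - real j)) = \<delta>\<^sub>2 ^ j * \<delta>\<^sub>2 powr (- (\<delta>\<^sub>2 * \<rho>))"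
      using assms by (simp add: powr_diff powr_minus powr_realpow field_simps)
    then show ?thesis using assms by (simp add: powr_def algebra_simps flip: exp_add)
  qed
  also have "\<dots> \<le> \<delta>\<^sub>2 ^ j * exp (\<rho> * (1 / 2))"
    using mult_left_mono[OF f(2) assms(1)] assms(4) by (intro mult_left_mono) (simp_all only: exp_le_cancel_iff, simp)
  finally show ?thesis by (simp add: algebra_simps)
qed

subsection \<open>Uniform estimate\<close>

text \<open>The size conditions of \<open>B_saddle_point\<close> with the bounds for \<alpha> and
  its derivative inserted. The last one holds because
  \<open>exp \<rho> * (1 - exp (- 1 / (100 * \<rho>)))\<close> grows like
  \<open>exp \<rho> / (100 * \<rho>)\<close>, which outweighs
  \<open>exp (\<rho> / 2)\<close>.\<close>

lemma saddle_point_conditions_eventually: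
  fixes \<delta> :: real
  shows "eventually (\<lambda>\<rho>::real. \<rho> \<ge> 1 \<and> 5 * ((1 + \<delta>) * exp (\<rho> / 2)) + 1 \<le> exp \<rho> / 8 \<and>
    exp (- exp \<rho> * (1 - exp (- 1 / (100 * \<rho>))) + 4 * exp (\<rho> / 2))
      * sqrt (2 * pi * \<rho> * (\<rho> + 1) * exp \<rho>) \<le> exp (- \<rho>)) at_top"
proof (intro eventually_conj)
  show "eventually (\<lambda>\<rho>::real. \<rho> \<ge> 1) at_top" by (rule eventually_ge_at_top)
  show "eventually (\<lambda>\<rho>::real. 5 * ((1 + \<delta>) * exp (\<rho> / 2)) + 1 \<le> exp \<rho> / 8) at_top"
    by real_asymp
  show "eventually (\<lambda>\<rho>::real. exp (- exp \<rho> * (1 - exp (- 1 / (100 * \<rho>))) + 4 * exp (\<rho> / 2))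
      * sqrt (2 * pi * \<rho> * (\<rho> + 1) * exp \<rho>) \<le> exp (- \<rho>)) at_top"
    by real_asymp
qed

text \<open>Near 0 and near infinity \<open>\<eta> * (1 - ln \<eta>)\<close> is below
  \<open>1 / 2\<close>; a value above \<open>1 / 2\<close> to the left of the first root or to the
  right of the second would force a third root. As the value at 1 is 1, the point 1 lies between the
  roots.\<close>

lemma threshold_exponents:
  fixes \<eta>\<^sub>1 \<eta>\<^sub>2 \<delta>\<^sub>1 \<delta>\<^sub>2 :: real
  assumes sol: "{\<eta>. 0 < \<eta> \<and> \<eta> * (1 - ln \<eta>) = 1 / 2} = {\<eta>\<^sub>1, \<eta>\<^sub>2}"
    and d: "0 < \<delta>\<^sub>1" "\<delta>\<^sub>1 < \<eta>\<^sub>1" "\<eta>\<^sub>1 < \<eta>\<^sub>2" "\<eta>\<^sub>2 < \<delta>\<^sub>2"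
  shows "\<delta>\<^sub>1 \<le> 1" "1 \<le> \<delta>\<^sub>2" "\<delta>\<^sub>1 * (1 - ln \<delta>\<^sub>1) \<le> 1 / 2" "\<delta>\<^sub>2 * (1 - ln \<delta>\<^sub>2) \<le> 1 / 2"
proof -
  define f where "f = (\<lambda>x::real. x * (1 - ln x))"
  have cont: "continuous_on {a..b} f" if "0 < a" for a b
    unfolding f_def using that by (auto intro!: continuous_intros)
  have roots: "x = \<eta>\<^sub>1 \<or> x = \<eta>\<^sub>2" if "0 < x" "f x = 1 / 2" for x
    using sol that unfolding f_def by blast
  have low: "f x \<le> 1 / 2" if "0 < x" "x < \<eta>\<^sub>1" for x
  proof (rule ccontr)
    assume "\<not> f x \<le> 1 / 2"
    have "eventually (\<lambda>y::real. y * (1 - ln y) < 1 / 2) (at_right 0)" by real_asymp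
    moreover have "eventually (\<lambda>y. y < x) (at_right 0)"
      using eventually_at_right[of 0 x] that by blast
    moreover have "eventually (\<lambda>y::real. 0 < y) (at_right 0)" by (rule eventually_at_right_less)
    ultimately have "eventually (\<lambda>y. f y < 1 / 2 \<and> y < x \<and> 0 < y) (at_right 0)"
      unfolding f_def by eventually_elim auto
    then obtain y where "f y < 1 / 2" "y < x" "0 < y"
      using eventually_happens' trivial_limit_at_right_real by blast
    then obtain z where "y \<le> z" "z \<le> x" "f z = 1 / 2"
      using IVT'[of f y "1 / 2" x] \<open>\<not> f x \<le> 1 / 2\<close> cont by auto
    then show False using roots[of z] \<open>0 < y\<close> that d by auto
  qed
  have high: "f x \<le> 1 / 2" if x: "\<eta>\<^sub>2 < x" for x
  proof (rule ccontr)
    assume *: "\<not> f x \<le> 1 / 2"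
    have "eventually (\<lambda>y::real. y * (1 - ln y) < 1 / 2) at_top" by real_asymp
    then have "eventually (\<lambda>y. f y < 1 / 2 \<and> x < y) at_top"
      unfolding f_def using eventually_gt_at_top[of x] by eventually_elim auto
    then obtain y where "f y < 1 / 2" "x < y"
      using eventually_happens' trivial_limit_at_top_linorder by blast
    then obtain z where "x \<le> z" "z \<le> y" "f z = 1 / 2"
      using IVT2'[of f y "1 / 2" x] * cont x d by auto
    then show False using roots[of z] x d by auto
  qed
  have f1: "\<not> f 1 \<le> 1 / 2" by (simp add: f_def)
  show "\<delta>\<^sub>1 \<le> 1" using low[of 1] f1 d by linarith
  show "1 \<le> \<delta>\<^sub>2" using high[of 1] f1 d by linarith
  show "\<delta>\<^sub>1 * (1 - ln \<delta>\<^sub>1) \<le> 1 / 2" using low[of \<delta>\<^sub>1] d by (simp add: f_def)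
  show "\<delta>\<^sub>2 * (1 - ln \<delta>\<^sub>2) \<le> 1 / 2" using high[of \<delta>\<^sub>2] d by (simp add: f_def)
qed

section \<open>Crude bounds for the finitely many small cases\<close>

lemma B_le_B_empty: "B n S \<le> B n {}"
  unfolding B_def by (rule card_mono) (auto intro: finite_subset[OF _ finitely_many_partition_on[of "{1..n}"]])

text \<open>For fixed \<open>n\<close> the relative error is bounded uniformly in \<open>S\<close>:
  \<open>B n S\<close> is at most \<open>B n {}\<close>, and
  \<open>\<alpha> S \<rho> \<le> exp \<rho>\<close> keeps the exponential factor of the main term
  above \<open>exp (- 1)\<close>. Since \<open>1 + a\<^sup>2 \<ge> 1\<close>, any real
  \<open>a\<close> may stand for the derivative.\<close>

lemma B_trivial_bound:
  fixes \<rho> :: real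
  assumes \<rho>: "\<rho> > 0"
  shows "\<exists>C\<ge>0. \<forall>S a. \<exists>\<epsilon>. real (B n S) = fact n * exp (exp \<rho> - 1 - \<alpha> S \<rho>)
            / (\<rho> ^ n * sqrt (2 * pi * \<rho> * (\<rho> + 1) * exp \<rho>)) * (1 + \<epsilon>)
      \<and> \<bar>\<epsilon>\<bar> \<le> C * ((1 + a\<^sup>2) / exp \<rho>)"
proof -
  define K where "K = \<rho> ^ n * sqrt (2 * pi * \<rho> * (\<rho> + 1) * exp \<rho>) / fact n"
  have K: "K > 0" using \<rho> by (simp add: K_def)
  define C where "C = (1 + B n {} * K * exp 1) * exp \<rho>"
  have "\<exists>\<epsilon>. real (B n S) = fact n * exp (exp \<rho> - 1 - \<alpha> S \<rho>)
            / (\<rho> ^ n * sqrt (2 * pi * \<rho> * (\<rho> + 1) * exp \<rho>)) * (1 + \<epsilon>)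
      \<and> \<bar>\<epsilon>\<bar> \<le> C * ((1 + a\<^sup>2) / exp \<rho>)" for S and a :: real
  proof -
    define M where "M = exp (exp \<rho> - 1 - \<alpha> S \<rho>)"
    define \<epsilon> where "\<epsilon> = B n S * K / M - 1"
    have M: "M > 0" by (simp add: M_def)
    have "exp (- 1) \<le> M" unfolding M_def using \<alpha>_le_exp[of \<rho> S] \<rho> by simp
    then have "1 / M \<le> exp 1" using M by (simp add: exp_minus field_simps)
    then have "B n S * K * (1 / M) \<le> B n {} * K * exp 1"
      using K M B_le_B_empty[of n S] by (intro mult_mono) auto
    moreover have "B n S * K / M \<ge> 0" using K M by simp
    ultimately have "\<bar>\<epsilon>\<bar> \<le> 1 + B n {} * K * exp 1" unfolding \<epsilon>_def by simp
    also have "\<dots> * 1 \<le> (1 + B n {} * K * exp 1) * (1 + a\<^sup>2)"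
      using K by (intro mult_left_mono) auto
    also have "\<dots> = C * ((1 + a\<^sup>2) / exp \<rho>)" by (simp add: C_def)
    finally have "\<bar>\<epsilon>\<bar> \<le> C * ((1 + a\<^sup>2) / exp \<rho>)" by simp
    moreover have "real (B n S) = M / K * (1 + \<epsilon>)" using K M by (simp add: \<epsilon>_def)
    ultimately show ?thesis
      by (intro exI[of _ \<epsilon>]) (simp add: K_def M_def mult_ac)
  qed
  moreover have "C \<ge> 0" using K by (simp add: C_def)
  ultimately show ?thesis by blast
qed

lemma r_pos: "n \<ge> 1 \<Longrightarrow> r n > 0"
  using r_eq[of n] by (metis exp_gt_zero of_nat_0_less_iff less_le_trans zero_less_mult_pos2 zero_less_one)

lemma less_mult_exp_if_r_less:
  assumes "n \<ge> 1" "r n < x"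
  shows "real n < x * exp x"
proof -
  have "r n * exp (r n) < x * exp x"
    using assms r_pos[OF assms(1)] by (intro mult_strict_mono) auto
  then show ?thesis using r_eq[OF assms(1)] by simp
qed

theorem theorem1:
  fixes \<eta>\<^sub>1 \<eta>\<^sub>2 \<delta>\<^sub>1 \<delta>\<^sub>2 :: real
  assumes "{\<eta>. 0 < \<eta> \<and> \<eta> * (1 - ln \<eta>) = 1 / 2} = {\<eta>\<^sub>1, \<eta>\<^sub>2}"
    and "0 < \<delta>\<^sub>1" and "\<delta>\<^sub>1 < \<eta>\<^sub>1" and "\<eta>\<^sub>1 < \<eta>\<^sub>2" and "\<eta>\<^sub>2 < \<delta>\<^sub>2"
  shows "\<exists>C::real. \<forall>n\<ge>1. \<forall>S. S \<subseteq> {1..} \<and> real ` S \<inter> {\<delta>\<^sub>1 * r n..\<delta>\<^sub>2 * r n} = {} \<longrightarrow>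
    (\<exists>\<epsilon>::real.
      real (B n S) = fact n * exp (exp (r n) - 1 - \<alpha> S (r n))
          / (r n ^ n * sqrt (2 * pi * r n * (r n + 1) * exp (r n))) * (1 + \<epsilon>)
      \<and> \<bar>\<epsilon>\<bar> \<le> C * ((1 + (deriv (\<alpha> S) (r n))\<^sup>2) / exp (r n)))"
proof -
  note \<delta> = threshold_exponents[OF assms]
  define good where "good = (\<lambda>C n S. \<exists>\<epsilon>::real.
      real (B n S) = fact n * exp (exp (r n) - 1 - \<alpha> S (r n))
          / (r n ^ n * sqrt (2 * pi * r n * (r n + 1) * exp (r n))) * (1 + \<epsilon>)
      \<and> \<bar>\<epsilon>\<bar> \<le> C * ((1 + (deriv (\<alpha> S) (r n))\<^sup>2) / exp (r n)))"
  have good_mono: "good C' n S" if "good C n S" "C \<le> C'" for C C' n S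
  proof -
    have "C * ((1 + (deriv (\<alpha> S) (r n))\<^sup>2) / exp (r n)) \<le> C' * ((1 + (deriv (\<alpha> S) (r n))\<^sup>2) / exp (r n))"
      using that(2) by (intro mult_right_mono) auto
    then show ?thesis using that(1) unfolding good_def by (meson order_trans)
  qed
  obtain x0 where x0: "\<And>\<rho>. \<rho> \<ge> x0 \<Longrightarrow> \<rho> \<ge> 1 \<and> 5 * ((1 + \<delta>\<^sub>2) * exp (\<rho> / 2)) + 1 \<le> exp \<rho> / 8 \<and>
    exp (- exp \<rho> * (1 - exp (- 1 / (100 * \<rho>))) + 4 * exp (\<rho> / 2))
      * sqrt (2 * pi * \<rho> * (\<rho> + 1) * exp \<rho>) \<le> exp (- \<rho>)"
    using saddle_point_conditions_eventually[of \<delta>\<^sub>2] unfolding eventually_at_top_linorder by blast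
  have large: "good 160001 n S"
    if "n \<ge> 1" "S \<subseteq> {1..}" "real ` S \<inter> {\<delta>\<^sub>1 * r n..\<delta>\<^sub>2 * r n} = {}" "r n \<ge> x0" for n S
  proof -
    define \<rho> where "\<rho> = r n"
    note c = x0[OF that(4), folded \<rho>_def]
    have dich: "real k < \<delta>\<^sub>1 * \<rho> \<or> \<delta>\<^sub>2 * \<rho> < real k" if "k \<in> S" for k
      using \<open>real ` S \<inter> _ = {}\<close> that by (force simp: \<rho>_def)
    have "\<alpha> S \<rho> \<le> (1 + \<delta>\<^sub>2 ^ 0) * exp (\<rho> / 2)"
      using c assms \<delta> dich by (intro \<alpha>_le_exp_half[of _ \<delta>\<^sub>1]) force+
    then have a0: "2 * \<alpha> S \<rho> \<le> 4 * exp (\<rho> / 2)" by simp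
    \<comment> \<open>If \<open>Suc k\<close> is below the gap then so is \<open>k\<close>; if
      \<open>Suc k\<close> is above it, then \<open>k + 1\<close> exceeds the upper threshold, which
      is the case \<open>j = 1\<close>.\<close>
    have "\<alpha> {k. Suc k \<in> S} \<rho> \<le> (1 + \<delta>\<^sub>2 ^ 1) * exp (\<rho> / 2)"
      using c assms \<delta> dich by (intro \<alpha>_le_exp_half[of _ \<delta>\<^sub>1]) force+
    then have a1: "5 * \<alpha> {k. Suc k \<in> S} \<rho> + 1 \<le> exp \<rho> / 8"
      using c by (simp only: power_one_right) linarith
    have "exp (- exp \<rho> * (1 - exp (- 1 / (100 * \<rho>))) + 2 * \<alpha> S \<rho>) * sqrt (2 * pi * \<rho> * (\<rho> + 1) * exp \<rho>)
      \<le> exp (- exp \<rho> * (1 - exp (- 1 / (100 * \<rho>))) + 4 * exp (\<rho> / 2)) * sqrt (2 * pi * \<rho> * (\<rho> + 1) * exp \<rho>)"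
      using a0 c by (intro mult_right_mono) auto
    also have "\<dots> \<le> exp (- \<rho>)" using c by blast
    finally show ?thesis
      using B_saddle_point[of S n \<rho>] a1 c that r_eq[OF that(1)]
      unfolding good_def deriv_\<alpha> \<rho>_def by simp
  qed
  have "\<exists>C\<ge>0. \<forall>S. good C n S" if "n \<ge> 1" for n
    using B_trivial_bound[OF r_pos[OF that], of n] unfolding good_def by blast
  then obtain Cf where Cf: "\<And>n. n \<ge> 1 \<Longrightarrow> Cf n \<ge> 0 \<and> (\<forall>S. good (Cf n) n S)" by metis
  \<comment> \<open>If \<open>r n < x0\<close>, then \<open>n < x0 * exp x0\<close>, so every
    exceptional \<open>n\<close> lies in \<open>{1..N}\<close>.\<close>
  define N where "N = nat \<lceil>x0 * exp x0\<rceil>"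
  \<comment> \<open>A sum of nonnegative constants dominates each of them; \<open>x0\<close>,
    \<open>N\<close> and \<open>Cf\<close> are chosen before \<open>n\<close> and \<open>S\<close>,
    so \<open>C\<close> is uniform in both.\<close>
  define C where "C = 160001 + (\<Sum>n\<in>{1..N}. Cf n)"
  have "(\<Sum>n\<in>{1..N}. Cf n) \<ge> 0" using Cf by (intro sum_nonneg) auto
  then have C1: "160001 \<le> C" by (simp add: C_def)
  have "good C n S" if n: "n \<ge> 1" and S: "S \<subseteq> {1..}" "real ` S \<inter> {\<delta>\<^sub>1 * r n..\<delta>\<^sub>2 * r n} = {}" for n S
  proof (cases "r n \<ge> x0")
    case True
    then show ?thesis using large[OF n S] good_mono C1 by blast
  next
    case False
    then have "real n < x0 * exp x0" using less_mult_exp_if_r_less[OF n] by simp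
    then have "n \<in> {1..N}" using n unfolding N_def by simp linarith
    then have "Cf n \<le> (\<Sum>n\<in>{1..N}. Cf n)" using Cf by (intro member_le_sum) auto
    then have "Cf n \<le> C" by (simp add: C_def)
    then show ?thesis using Cf[OF n] good_mono by blast
  qed
  then show ?thesis unfolding good_def by blast
qed

end
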